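(* Let $N\ge 2$, $M\ge 2$ be integers, let $0<r\le 1/N$, let $\{f_1,\dots,f_N\}$ be an IFS on $[0,1]$ as in the context, let $\mathbf{p}=(p_1,\dots,p_N)$ be a probability vector, and let $F=F(\omega)$ be the random set defined in the context. Then there is a constant $a\ge 0$ (not depending on $\omega$) such that, for $\mu_{\mathbf p}$-almost every $\omega$, $$\dim_H F(\omega)=\underline{\dim}_B F(\omega)=\overline{\dim}_B F(\omega)=a.$$
   Context: IFS: $f_i:[0,1]\to[0,1]$, $f_i(x)=rx+b_i$ for $i=1,\dots,N$, with constants $b_i$ such that the open intervals $f_i((0,1))$ are pairwise disjoint and $f_i([0,1])$ lies to the left of $f_j([0,1])$ when $i<j$. Probability space: $\Omega=\{1,\dots,N\}^{\mathbb N}$ ($\mathbb N=\{1,2,\dots\}$) with its Borel $\sigma$-algebra and the product measure $\mu_{\mathbf p}$ under which the coordinates $\omega_1,\omega_2,\dots$ are i.i.d. with $\mu_{\mathbf p}(\omega_k=i)=p_i$. Tree: let $\mathcal I_n=\{1,\dots,M\}^n$, $\mathcal I_0=\{\epsilon\}$ with $\epsilon$ the empty word, $\mathcal I^*=\bigcup_{n\ge0}\mathcal I_n$, and $\mathcal I=\{1,\dots,M\}^{\mathbb N}$. Order $\mathcal I^*$ by: $\mathbf i<_*\mathbf j$ if $\mathbf i$ is shorter than $\mathbf j$, or if they have equal length and $\mathbf i$ precedes $\mathbf j$ lexicographically. Put $\kappa(\mathbf i)=\#\{\mathbf j\in\mathcal I^*:\mathbf j<_*\mathbf i\}$, so that $\kappa$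 maps the nonempty words bijectively onto $\mathbb N$. For nonempty $\mathbf i\in\mathcal I^*$ let $X_{\mathbf i}(\omega)=\omega_{\kappa(\mathbf i)}$ (the random label of the edge of the $M$-ary tree leading to the node $\mathbf i$). Random set: writing $\mathbf i|_k=(i_1,\dots,i_k)$, $$F(\omega)=\Big\{x:\ \{x\}=\bigcap_{n\ge1} f_{X_{\mathbf i|_1}(\omega)}\circ f_{X_{\mathbf i|_2}(\omega)}\circ\dots\circ f_{X_{\mathbf i|_n}(\omega)}([0,1])\ \text{ for some }\mathbf i\in\mathcal I\Big\}.$$ $\dim_H$, $\underline{\dim}_B$, $\overline{\dim}_B$ are the Hausdorff, lower box-counting and upper box-counting dimensions. *)

theory Defs
  imports "HOL-Probability.Probability"
begin

(* The convention for |U|^s at s = 0 is explicit because 0 powr 0 = 0: a nonempty set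
   contributes 1 and the empty set contributes 0. *)
definition diam_pow :: "real \<Rightarrow> 'a::metric_space set \<Rightarrow> ennreal" where
  "diam_pow s U =
     (if U = {} then 0 else if s = 0 then 1 else ennreal (diameter U powr s))"

(* Boundedness is required because diameter is only meaningful for bounded sets.
   Finite covers are included, since members of the sequence may be empty. *)
definition hausdorff_premeasure :: "real \<Rightarrow> real \<Rightarrow> 'a::metric_space set \<Rightarrow> ennreal" where
  "hausdorff_premeasure s \<delta> A =
     Inf {(\<Sum>n. diam_pow s (U n)) | U :: nat \<Rightarrow> 'a set.
            A \<subseteq> (\<Union>n. U n) \<and> (\<forall>n. bounded (U n) \<and> diameter (U n) \<le> \<delta>)}"

definition hausdorff_measure :: "real \<Rightarrow> 'a::metric_space set \<Rightarrow> ennreal" where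
  "hausdorff_measure s A = (SUP \<delta>\<in>{0<..}. hausdorff_premeasure s \<delta> A)"

definition hausdorff_dim :: "'a::metric_space set \<Rightarrow> ereal" where
  "hausdorff_dim A = Inf {ereal s | s. 0 \<le> s \<and> hausdorff_measure s A = 0}"

(* Only meaningful for totally bounded A; otherwise the least element is unspecified. *)
definition covering_number :: "real \<Rightarrow> 'a::metric_space set \<Rightarrow> nat" where
  "covering_number \<delta> A =
     (LEAST n. \<exists>C. finite C \<and> card C = n \<and> A \<subseteq> \<Union>C \<and>
                   (\<forall>U\<in>C. bounded U \<and> diameter U \<le> \<delta>))"

(* As usual, the box-counting dimensions are intended for nonempty totally bounded sets. *)
definition lower_box_dim :: "'a::metric_space set \<Rightarrow> ereal" where
  "lower_box_dim A =
     Liminf (at_right 0) (\<lambda>\<delta>. ereal (ln (real (covering_number \<delta> A)) / (- ln \<delta>)))"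

definition upper_box_dim :: "'a::metric_space set \<Rightarrow> ereal" where
  "upper_box_dim A =
     Limsup (at_right 0) (\<lambda>\<delta>. ereal (ln (real (covering_number \<delta> A)) / (- ln \<delta>)))"

definition ifs_map :: "real \<Rightarrow> (nat \<Rightarrow> real) \<Rightarrow> nat \<Rightarrow> real \<Rightarrow> real" where
  "ifs_map r b i x = r * x + b i"

(* Coordinates are indexed by 1, 2, ...; the factors carry the discrete sigma-algebra on
   the finite set {1..N}, so the product sigma-algebra is the Borel sigma-algebra. *)
definition label_measure :: "nat \<Rightarrow> (nat \<Rightarrow> real) \<Rightarrow> (nat \<Rightarrow> nat) measure" where
  "label_measure N p = Pi\<^sub>M {1..} (\<lambda>_. point_measure {1..N} (\<lambda>i. ennreal (p i)))"

(* lenlex compares first by length and then lexicographically. *)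
definition word_index :: "nat \<Rightarrow> nat list \<Rightarrow> nat" where
  "word_index M w = card {v \<in> lists {1..M}. (v, w) \<in> lenlex less_than}"

definition edge_label :: "nat \<Rightarrow> (nat \<Rightarrow> nat) \<Rightarrow> nat list \<Rightarrow> nat" where
  "edge_label M \<omega> w = \<omega> (word_index M w)"

definition word_prefix :: "(nat \<Rightarrow> nat) \<Rightarrow> nat \<Rightarrow> nat list" where
  "word_prefix u k = map u [1..<Suc k]"

(* The composition over k = 1, ..., n, with the map for k = 1 outermost. *)
definition branch_map ::
  "nat \<Rightarrow> real \<Rightarrow> (nat \<Rightarrow> real) \<Rightarrow> (nat \<Rightarrow> nat) \<Rightarrow> (nat \<Rightarrow> nat) \<Rightarrow> nat \<Rightarrow> real \<Rightarrow> real" where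
  "branch_map M r b \<omega> u n =
     foldr (\<lambda>k g. ifs_map r b (edge_label M \<omega> (word_prefix u k)) \<circ> g) [1..<Suc n] id"

definition random_set ::
  "nat \<Rightarrow> real \<Rightarrow> (nat \<Rightarrow> real) \<Rightarrow> (nat \<Rightarrow> nat) \<Rightarrow> real set" where
  "random_set M r b \<omega> =
     {x. \<exists>u \<in> {1..} \<rightarrow>\<^sub>E {1..M}. {x} = (\<Inter>n\<in>{1..}. branch_map M r b \<omega> u n ` {0..1})}"

end

theory Submission
  imports Defs
begin

text \<open>
  Write \<open>N\<^sub>k\<close> for the number of different label words of length \<open>k\<close> that occur along the
  paths of length \<open>k\<close> from the root (\<open>level_count\<close>), and let \<open>E N\<^sub>k\<close> be its mean
  (\<open>mean_count\<close>). Each label word of length \<open>k\<close> stands for a cell of length \<open>r ^ k\<close>, and the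
  \<open>N\<^sub>k\<close> cells of the occurring words cover the random set. The constant is
  \<open>a = limsup ln (E N\<^sub>k) / (k ln (1 / r))\<close> (\<open>growth\<close>). Since Hausdorff dimension never exceeds
  lower box dimension (\<open>hausdorff_dim_le_lower_box_dim\<close>), it suffices to bound the upper box
  dimension from above by \<open>a\<close> and the Hausdorff dimension from below by \<open>a\<close>, almost surely.

  Upper bound. By Markov's inequality, \<open>N\<^sub>k\<close> exceeds \<open>E N\<^sub>k\<close> by a factor \<open>exp (\<epsilon> k)\<close> with
  probability at most \<open>exp (- \<epsilon> k)\<close>, so by Borel and Cantelli this happens for finitely many \<open>k\<close>
  only (\<open>AE_level_count_le\<close>).

  Lower bound. The tree is called \<open>d\<close>-regular with step \<open>k\<close> if \<open>d\<close> nodes at depth \<open>k\<close> have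
  different label words and are again roots of \<open>d\<close>-regular trees. If some subtree is
  \<open>d\<close>-regular, the limit set contains points coded by all sequences of digits below \<open>d\<close>, where
  each further digit shrinks the cell by \<open>r ^ k\<close> and the cells of different codes of equal length
  overlap in at most an end point. Its dimension is therefore at least
  \<open>ln d / (k ln (1 / r))\<close> (\<open>hausdorff_dim_limit_set_ge\<close>).

  Regular subtrees exist for a \<open>d\<close> that is almost \<open>E N\<^sub>k\<close>. As \<open>N\<^sub>k \<le> M ^ k\<close>, some threshold \<open>h\<close>
  satisfies \<open>h P(N\<^sub>k \<ge> h) \<ge> E N\<^sub>k / (1 + k ln M)\<close>: otherwise summing \<open>P(N\<^sub>k \<ge> h)\<close> over \<open>h\<close> would
  give a harmonic sum that is too small (\<open>heavy_tail\<close>). Put \<open>c = P(N\<^sub>k \<ge> h)\<close> and \<open>d = h c / 4\<close>,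
  rounded down. By induction on \<open>j\<close>, the tree is \<open>d\<close>-regular to depth \<open>j\<close> blocks with
  probability at least \<open>c / 2\<close>: with probability \<open>c\<close> there are \<open>h\<close> nodes at depth \<open>k\<close> with
  different label words, their subtrees are independent, so on average at least \<open>h c / 2 \<ge> 2 d\<close>
  of these are regular to depth \<open>j\<close>, and by Chebyshev's inequality at least \<open>d\<close> of them are, with
  conditional probability at least one half (\<open>prob_regular\<close>). Letting \<open>j\<close> tend to infinity, the
  tree is \<open>d\<close>-regular with positive probability, and since it contains infinitely many independent
  copies of itself, almost surely some subtree is (\<open>AE_regular_subtree\<close>). The factor lost between
  \<open>E N\<^sub>k\<close> and \<open>d\<close> is linear in \<open>k\<close> and disappears along a sequence of \<open>k\<close> that realises the
  limes superior.
\<close>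

section \<open>Comparison of Hausdorff and box-counting dimension\<close>

lemma covering_number_le:
  fixes A :: "'a::metric_space set"
  assumes "finite C" "A \<subseteq> \<Union>C" "\<And>U. U \<in> C \<Longrightarrow> bounded U \<and> diameter U \<le> \<delta>"
  shows "covering_number \<delta> A \<le> card C"
  unfolding covering_number_def using assms by (intro Least_le) blast

lemma covering_number_attained:
  fixes A :: "'a::metric_space set"
  assumes "\<exists>C. finite C \<and> A \<subseteq> \<Union>C \<and> (\<forall>U\<in>C. bounded U \<and> diameter U \<le> \<delta>)"
  obtains C where "finite C" "card C = covering_number \<delta> A" "A \<subseteq> \<Union>C"
    "\<forall>U\<in>C. bounded U \<and> diameter U \<le> \<delta>"
proof -
  from assms have "\<exists>n C. finite C \<and> card C = n \<and> A \<subseteq> \<Union>C \<and> (\<forall>U\<in>C. bounded U \<and> diameter U \<le> \<delta>)"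
    by blast
  from LeastI_ex[OF this] show ?thesis
    unfolding covering_number_def[symmetric] using that by blast
qed

text \<open>
  The sets of an optimal finite cover, padded with empty sets, form a countable cover in which each
  nonempty member contributes at most \<open>\<delta> powr t\<close>.
\<close>
lemma hausdorff_premeasure_le_covering:
  fixes A :: "'a::metric_space set"
  assumes C: "\<exists>C. finite C \<and> A \<subseteq> \<Union>C \<and> (\<forall>U\<in>C. bounded U \<and> diameter U \<le> \<delta>)"
    and \<delta>: "0 < \<delta>" and t: "0 < t"
  shows "hausdorff_premeasure t \<delta> A \<le> ennreal (real (covering_number \<delta> A) * \<delta> powr t)"
proof -
  obtain C where C: "finite C" "card C = covering_number \<delta> A" "A \<subseteq> \<Union>C"
    "\<forall>U\<in>C. bounded U \<and> diameter U \<le> \<delta>"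
    using covering_number_attained[OF C] .
  obtain e where e: "bij_betw e {..<card C} C"
    using bij_betw_from_nat_into_finite[OF C(1)] by blast
  define U where "U n = (if n < card C then e n else {})" for n
  have UC: "U n \<in> C" if "n < card C" for n
    using that bij_betwE[OF e] by (auto simp: U_def)
  have cov: "A \<subseteq> (\<Union>n. U n)"
  proof
    fix x assume "x \<in> A"
    then obtain V where "V \<in> C" "x \<in> V" using C(3) by blast
    then obtain n where "n < card C" "V = e n"
      using bij_betw_imp_surj_on[OF e] by (metis imageE lessThan_iff)
    then have "x \<in> U n" using \<open>x \<in> V\<close> by (simp add: U_def)
    then show "x \<in> (\<Union>n. U n)" by blast
  qed
  have U: "bounded (U n) \<and> diameter (U n) \<le> \<delta>" for n
    using UC[of n] C(4) \<delta> by (cases "n < card C") (auto simp: U_def diameter_def)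
  have "diam_pow t (U n) \<le> (if n < card C then ennreal (\<delta> powr t) else 0)" for n
    using U[of n] t UC[of n] diameter_ge_0[of "U n"]
    by (auto simp: diam_pow_def U_def intro!: ennreal_leI powr_mono2)
  then have "(\<Sum>n. diam_pow t (U n)) \<le> (\<Sum>n. if n < card C then ennreal (\<delta> powr t) else 0)"
    by (intro suminf_le) auto
  also have "\<dots> = (\<Sum>n\<in>{..<card C}. ennreal (\<delta> powr t))"
    by (subst suminf_finite[of "{..<card C}"]) auto
  also have "\<dots> = ennreal (real (covering_number \<delta> A) * \<delta> powr t)"
    by (simp add: C(2) ennreal_mult ennreal_of_nat_eq_real_of_nat)
  finally have "(\<Sum>n. diam_pow t (U n)) \<le> ennreal (real (covering_number \<delta> A) * \<delta> powr t)" .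
  moreover have "hausdorff_premeasure t \<delta> A \<le> (\<Sum>n. diam_pow t (U n))"
    unfolding hausdorff_premeasure_def using cov U by (intro Inf_lower) blast
  ultimately show ?thesis by order
qed

lemma hausdorff_premeasure_antimono:
  "\<delta> \<le> \<epsilon> \<Longrightarrow> hausdorff_premeasure t \<epsilon> A \<le> hausdorff_premeasure t \<delta> A"
  unfolding hausdorff_premeasure_def by (intro Inf_superset_mono Collect_mono ex_mono impI) (meson order_trans)

lemma hausdorff_dim_nonneg: "0 \<le> hausdorff_dim A"
  unfolding hausdorff_dim_def by (intro Inf_greatest) auto

lemma lower_box_dim_nonneg: "0 \<le> lower_box_dim A"
  unfolding lower_box_dim_def
proof (rule Liminf_bounded)
  have "eventually (\<lambda>\<delta>::real. 0 < \<delta> \<and> \<delta> < 1) (at_right 0)"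
    by (intro eventually_at_rightI[of 0 1]) auto
  then show "\<forall>\<^sub>F \<delta>::real in at_right 0. 0 \<le> ereal (ln (real (covering_number \<delta> A)) / - ln \<delta>)"
  proof eventually_elim
    case (elim \<delta>)
    have "0 \<le> ln (real n)" for n :: nat
      by (cases n) auto
    with elim have "0 \<le> ln (real (covering_number \<delta> A)) / - ln \<delta>"
      by (intro divide_nonneg_nonneg) auto
    then show ?case by simp
  qed
qed

lemma lower_box_dim_le_upper_box_dim: "lower_box_dim A \<le> upper_box_dim A"
  unfolding lower_box_dim_def upper_box_dim_def
  by (intro Liminf_le_Limsup) simp

text \<open>
  For \<open>s\<close> above the lower box dimension there are arbitrarily small scales \<open>\<delta>\<close> at which
  \<open>\<delta> powr (- s)\<close> sets suffice. For \<open>t > s\<close> their total weight is at most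
  \<open>\<delta> powr (t - s)\<close>, which tends to 0.
\<close>
lemma hausdorff_dim_le_lower_box_dim:
  fixes A :: "'a::metric_space set"
  assumes cov: "\<And>\<delta>. 0 < \<delta> \<Longrightarrow> \<exists>C. finite C \<and> A \<subseteq> \<Union>C \<and> (\<forall>U\<in>C. bounded U \<and> diameter U \<le> \<delta>)"
  shows "hausdorff_dim A \<le> lower_box_dim A"
proof (rule ccontr)
  assume "\<not> hausdorff_dim A \<le> lower_box_dim A"
  then have "lower_box_dim A < hausdorff_dim A" by simp
  then obtain t where t: "lower_box_dim A < ereal t" "ereal t < hausdorff_dim A"
    using ereal_dense2 by blast
  obtain s where s: "lower_box_dim A < ereal s" "ereal s < ereal t"
    using ereal_dense2[OF t(1)] by blast
  have "0 \<le> lower_box_dim A" by (rule lower_box_dim_nonneg)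
  then have "0 < ereal s" using s(1) by order
  with s have s0: "0 < s" "s < t" by auto
  have freq: "\<exists>\<^sub>F \<delta> in at_right 0. ereal (ln (real (covering_number \<delta> A)) / - ln \<delta>) < ereal s"
  proof (rule ccontr)
    assume "\<not> ?thesis"
    then have "\<forall>\<^sub>F \<delta> in at_right 0. ereal s \<le> ereal (ln (real (covering_number \<delta> A)) / - ln \<delta>)"
      by (simp add: not_frequently not_less)
    then have "ereal s \<le> lower_box_dim A" unfolding lower_box_dim_def by (rule Liminf_bounded)
    with s(1) show False by order
  qed
  have "hausdorff_premeasure t \<epsilon> A \<le> ennreal \<eta>" if "0 < \<epsilon>" "0 < \<eta>" for \<epsilon> \<eta>
  proof -
    have "((\<lambda>\<delta>. \<delta> powr (t - s)) \<longlongrightarrow> 0) (at_right (0::real))"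
    proof -
      have "((\<lambda>\<delta>. \<delta> powr (t - s)) \<longlongrightarrow> 0 powr (t - s)) (at_right (0::real))"
        using s0 by (intro tendsto_powr2 tendsto_intros) (auto simp: eventually_at_filter)
      then show ?thesis by simp
    qed
    then have "\<forall>\<^sub>F \<delta> in at_right 0. \<delta> powr (t - s) < \<eta>"
      using that(2) by (rule order_tendstoD)
    moreover have "\<forall>\<^sub>F \<delta> in at_right 0. 0 < \<delta> \<and> \<delta> < min 1 \<epsilon>"
      using that by (intro eventually_at_rightI[of 0 "min 1 \<epsilon>"]) auto
    ultimately have ev: "\<forall>\<^sub>F \<delta> in at_right 0. (0 < \<delta> \<and> \<delta> < min 1 \<epsilon>) \<and> \<delta> powr (t - s) < \<eta>"
      by eventually_elim auto
    obtain \<delta> where d: "ereal (ln (real (covering_number \<delta> A)) / - ln \<delta>) < ereal s"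
      "0 < \<delta>" "\<delta> < 1" "\<delta> < \<epsilon>" "\<delta> powr (t - s) < \<eta>"
      using frequently_ex[OF frequently_eventually_frequently[OF freq ev]] by auto
    have "ln (real (covering_number \<delta> A)) \<le> s * - ln \<delta>"
      using d by (simp add: field_simps)
    then have "real (covering_number \<delta> A) \<le> exp (s * - ln \<delta>)"
      by (cases "covering_number \<delta> A = 0") (auto simp: ln_le_cancel_iff[symmetric] simp del: ln_le_cancel_iff)
    also have "\<dots> = \<delta> powr (-s)" using d by (simp add: powr_def)
    finally have "real (covering_number \<delta> A) * \<delta> powr t \<le> \<delta> powr (-s) * \<delta> powr t"
      by (intro mult_right_mono) auto
    also have "\<dots> = \<delta> powr (t - s)" by (simp add: powr_add[symmetric])
    finally have "ennreal (real (covering_number \<delta> A) * \<delta> powr t) \<le> ennreal \<eta>"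
      using d by (intro ennreal_leI) simp
    moreover have "hausdorff_premeasure t \<delta> A \<le> ennreal (real (covering_number \<delta> A) * \<delta> powr t)"
      using d s0 by (intro hausdorff_premeasure_le_covering cov) auto
    moreover have "hausdorff_premeasure t \<epsilon> A \<le> hausdorff_premeasure t \<delta> A"
      using d by (intro hausdorff_premeasure_antimono) simp
    ultimately show ?thesis by order
  qed
  then have small: "hausdorff_premeasure t \<epsilon> A \<le> 0 + ennreal \<eta>" if "0 < \<epsilon>" "0 < \<eta>" for \<epsilon> \<eta>
    using that by simp
  have "hausdorff_premeasure t \<epsilon> A \<le> 0" if "0 < \<epsilon>" for \<epsilon>
    by (rule ennreal_le_epsilon) (rule small[OF that])
  then have "hausdorff_measure t A \<le> 0"
    unfolding hausdorff_measure_def by (intro SUP_least) simp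
  then have "hausdorff_measure t A = 0" by simp
  then have "hausdorff_dim A \<le> ereal t"
    unfolding hausdorff_dim_def using s0 by (intro Inf_lower) auto
  with t(2) show False by order
qed

section \<open>Hausdorff dimension of Cantor sets with a regular coding\<close>

text \<open>
  The integer parts of \<open>(x v - y0) / L\<close> are different for different \<open>v\<close>, because the \<open>x v\<close> are
  \<open>L\<close>-separated, and they all lie between -2 and 1, because every interval comes within \<open>L\<close> of the
  point \<open>y0\<close> of \<open>U\<close>.
\<close>
lemma card_separated_hits_le:
  fixes x :: "'a \<Rightarrow> real"
  assumes L: "0 < L" and U: "bounded U" "diameter U \<le> L"
    and sep: "\<And>u v. u \<in> V \<Longrightarrow> v \<in> V \<Longrightarrow> u \<noteq> v \<Longrightarrow> L \<le> \<bar>x u - x v\<bar>"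
    and hit: "\<And>v. v \<in> V \<Longrightarrow> \<exists>y\<in>U. x v \<le> y \<and> y \<le> x v + L"
  shows "finite V \<and> card V \<le> 4"
proof (cases "V = {}")
  case False
  then obtain y0 where y0: "y0 \<in> U" using hit by blast
  define f where "f v = \<lfloor>(x v - y0) / L\<rfloor>" for v
  have "f v \<in> {-2..1}" if v: "v \<in> V" for v
  proof -
    obtain y where y: "y \<in> U" "x v \<le> y" "y \<le> x v + L" using hit[OF v] by blast
    have "\<bar>y - y0\<bar> \<le> L"
      using diameter_bounded_bound[OF U(1) y(1) y0] U(2) by (simp add: dist_real_def)
    then have "-2 * L \<le> x v - y0" "x v - y0 \<le> L" using y by auto
    then have "-2 \<le> (x v - y0) / L" "(x v - y0) / L \<le> 1"
      using L by (simp_all add: field_simps)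
    then show ?thesis unfolding f_def by (simp add: le_floor_iff)
  qed
  then have im: "f ` V \<subseteq> {-2..1}" by blast
  have inj: "inj_on f V"
  proof (rule inj_onI, rule ccontr)
    fix u v assume uv: "u \<in> V" "v \<in> V" "f u = f v" "u \<noteq> v"
    have "\<bar>(x u - y0) / L - (x v - y0) / L\<bar> < 1"
      using uv(3) unfolding f_def by linarith
    moreover have "(x u - y0) / L - (x v - y0) / L = (x u - x v) / L"
      by (simp add: diff_divide_distrib)
    ultimately have "\<bar>x u - x v\<bar> < L" using L by (simp add: abs_divide)
    with sep[OF uv(1,2,4)] show False by simp
  qed
  have "finite V" using inj_on_finite[OF inj im] by simp
  moreover have "card V \<le> card {-2..1::int}" using card_inj_on_le[OF inj im] by simp
  ultimately show ?thesis by simp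
qed simp

lemma uniform_cylinder_emeasure:
  fixes v :: "nat list"
  assumes d: "0 < d" and v: "length v = n" "set v \<subseteq> {..<d}"
  defines "P \<equiv> PiM UNIV (\<lambda>_::nat. uniform_count_measure {..<d})"
  shows "{z \<in> space P. map z [0..<n] = v} \<in> sets P"
    and "emeasure P {z \<in> space P. map z [0..<n] = v} = ennreal ((1 / real d) ^ n)"
proof -
  have "prob_space (uniform_count_measure {..<d})"
    using d by (intro prob_space_uniform_count_measure) auto
  then interpret product_prob_space "\<lambda>_. uniform_count_measure {..<d}" "UNIV :: nat set"
    by (intro product_prob_spaceI)
  have eq: "{z \<in> space P. map z [0..<n] = v} = {z \<in> space P. \<forall>i\<in>{..<n}. z i \<in> {v ! i}}"
    using v(1) by (auto simp: list_eq_iff_nth_eq)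
  have vi: "{v ! i} \<in> sets (uniform_count_measure {..<d})" if "i \<in> {..<n}" for i
    using v(2) subsetD[OF v(2) nth_mem[of i v]] that v(1) by (auto simp: sets_uniform_count_measure)
  show "{z \<in> space P. map z [0..<n] = v} \<in> sets P"
    unfolding eq unfolding P_def
  proof (intro sets.sets_Collect_finite_All)
    fix i assume i: "i \<in> {..<n}"
    have "(\<lambda>z. z i) \<in> measurable (PiM UNIV (\<lambda>_::nat. uniform_count_measure {..<d})) (uniform_count_measure {..<d})"
      by (rule measurable_component_singleton) simp
    from measurable_sets[OF this vi[OF i]]
    show "{x \<in> space (PiM UNIV (\<lambda>_::nat. uniform_count_measure {..<d})). x i \<in> {v ! i}}
      \<in> sets (PiM UNIV (\<lambda>_. uniform_count_measure {..<d}))"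
      by (simp add: vimage_def Int_def conj_commute)
  qed auto
  have "emeasure P {z \<in> space P. map z [0..<n] = v} =
      (\<Prod>i\<in>{..<n}. emeasure (uniform_count_measure {..<d}) {v ! i})"
    unfolding eq unfolding P_def using vi by (intro emeasure_PiM_Collect) auto
  also have "\<dots> = (\<Prod>i\<in>{..<n}. ennreal (1 / real d))"
  proof (rule prod.cong[OF refl])
    fix i assume i: "i \<in> {..<n}"
    have "v ! i < d" using subsetD[OF v(2) nth_mem[of i v]] v(1) i by auto
    then show "emeasure (uniform_count_measure {..<d}) {v ! i} = ennreal (1 / real d)"
      using d by (subst emeasure_uniform_count_measure) (auto simp: )
  qed
  also have "\<dots> = ennreal ((1 / real d) ^ n)"
    by (simp add: ennreal_power)
  finally show "emeasure P {z \<in> space P. map z [0..<n] = v} = ennreal ((1 / real d) ^ n)" .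
qed

lemma geometric_scale:
  fixes \<rho> C D :: real
  assumes "0 < \<rho>" "\<rho> < 1" "0 < D" "D \<le> C"
  obtains n where "C * \<rho> ^ Suc n < D" "D \<le> C * \<rho> ^ n"
proof -
  have "(\<lambda>n. C * \<rho> ^ n) \<longlonglongrightarrow> C * 0"
    using assms by (intro tendsto_intros LIMSEQ_realpow_zero) auto
  then have "\<forall>\<^sub>F n in sequentially. C * \<rho> ^ n < D"
    using assms by (intro order_tendstoD) auto
  then have ex: "\<exists>n. C * \<rho> ^ n < D" by (auto simp: eventually_sequentially)
  define m where "m = (LEAST n. C * \<rho> ^ n < D)"
  have m: "C * \<rho> ^ m < D" unfolding m_def by (rule LeastI_ex[OF ex])
  have "m \<noteq> 0" using m assms by (intro notI) simp
  then obtain n where n: "m = Suc n" by (cases m) auto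
  have "\<not> C * \<rho> ^ n < D" using n not_less_Least[of n "\<lambda>n. C * \<rho> ^ n < D"] unfolding m_def by simp
  with m n show ?thesis by (intro that[of n]) auto
qed

text \<open>
  Mass distribution principle for a Cantor set in which every cell of length \<open>C * \<rho> ^ n\<close> has
  \<open>d\<close> subcells of length \<open>C * \<rho> ^ (n + 1)\<close>; \<open>x v\<close> is the left end point of the cell with code
  \<open>v\<close>. Draw a code from the uniform product measure. A set of diameter at most \<open>C * \<rho> ^ n\<close> meets at
  most four cells of generation \<open>n\<close>, each of mass \<open>d ^ (- n)\<close>, so its mass is at most a
  constant times its diameter to the power \<open>t\<close>, for every \<open>t\<close> below the similarity dimension.

  The estimate is carried out on the space of codes: \<open>B U\<close> consists of the codes all of whose cells
  meet \<open>U\<close>. It contains each code of a point of \<open>U\<close>, and it is measurable even if \<open>U\<close> is not, because each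
  generation contributes a condition on finitely many digits.
\<close>
theorem hausdorff_dim_ge_regular_tree:
  fixes A :: "real set" and x :: "nat list \<Rightarrow> real"
  assumes d: "1 < d" and \<rho>: "0 < \<rho>" "\<rho> < 1" and C: "0 < C"
    and sep: "\<And>u v. length u = length v \<Longrightarrow> set u \<subseteq> {..<d} \<Longrightarrow> set v \<subseteq> {..<d} \<Longrightarrow> u \<noteq> v
      \<Longrightarrow> C * \<rho> ^ length u \<le> \<bar>x u - x v\<bar>"
    and pt: "\<And>z :: nat \<Rightarrow> nat. (\<forall>i. z i < d) \<Longrightarrow>
      \<exists>y\<in>A. \<forall>n. x (map z [0..<n]) \<le> y \<and> y \<le> x (map z [0..<n]) + C * \<rho> ^ n"
  shows "ereal (ln (real d) / ln (1 / \<rho>)) \<le> hausdorff_dim A"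
  unfolding hausdorff_dim_def
proof (rule Inf_greatest, safe)
  fix t :: real assume t: "0 \<le> t" "hausdorff_measure t A = 0"
  define s where "s = ln (real d) / ln (1 / \<rho>)"
  have ln\<rho>: "0 < ln (1 / \<rho>)" using \<rho> by simp
  have \<rho>s: "\<rho> powr s = 1 / real d"
  proof -
    have "s * ln \<rho> = - ln (real d)" using ln\<rho> \<rho> by (simp add: s_def ln_div field_simps)
    then show ?thesis using \<rho> d by (simp add: powr_def exp_minus inverse_eq_divide)
  qed
  have "s \<le> t"
  proof (rule ccontr)
    assume "\<not> s \<le> t"
    then have ts: "t < s" by simp
    define P where "P = PiM UNIV (\<lambda>_::nat. uniform_count_measure {..<d})"
    have spaceP: "space P = {z. \<forall>i. z i < d}"
      by (auto simp: P_def space_PiM space_uniform_count_measure PiE_def)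
    have "prob_space P"
      unfolding P_def using d
      by (intro prob_space_PiM prob_space_uniform_count_measure) auto
    then interpret P: prob_space P .
    define Hit where "Hit n U = {v. length v = n \<and> set v \<subseteq> {..<d} \<and>
      (\<exists>y\<in>U. x v \<le> y \<and> y \<le> x v + C * \<rho> ^ n)}" for n U
    define B where "B U = {z \<in> space P. \<forall>n. map z [0..<n] \<in> Hit n U}" for U
    have cyl: "{z \<in> space P. map z [0..<n] = v} \<in> sets P"
      "emeasure P {z \<in> space P. map z [0..<n] = v} = ennreal ((1 / real d) ^ n)" if "v \<in> Hit n U" for n v U
      using uniform_cylinder_emeasure[of d v n] d that by (auto simp: Hit_def P_def)
    have finHit: "finite (Hit n U)" for n U
      by (rule finite_subset[OF _ finite_lists_length_eq[of "{..<d}" n]]) (auto simp: Hit_def)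
    have hitsets: "{z \<in> space P. map z [0..<n] \<in> Hit n U} \<in> sets P" for n U
    proof -
      have "{z \<in> space P. map z [0..<n] \<in> Hit n U} = (\<Union>v\<in>Hit n U. {z \<in> space P. map z [0..<n] = v})"
        by auto
      also have "\<dots> \<in> sets P" using finHit cyl(1) by (intro sets.finite_UN) auto
      finally show ?thesis .
    qed
    have Bsets: "B U \<in> sets P" for U
      unfolding B_def using hitsets by (intro sets.sets_Collect_countable_All) auto
    have B4: "emeasure P (B U) \<le> ennreal (4 * (1 / real d) ^ n)"
      if U: "bounded U" "diameter U \<le> C * \<rho> ^ n" for U n
    proof -
      have "B U \<subseteq> (\<Union>v\<in>Hit n U. {z \<in> space P. map z [0..<n] = v})" by (auto simp: B_def)
      then have "emeasure P (B U) \<le> emeasure P (\<Union>v\<in>Hit n U. {z \<in> space P. map z [0..<n] = v})"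
        using finHit cyl(1) by (intro emeasure_mono sets.finite_UN) auto
      also have "\<dots> \<le> (\<Sum>v\<in>Hit n U. emeasure P {z \<in> space P. map z [0..<n] = v})"
        using finHit cyl(1) by (intro emeasure_subadditive_finite) auto
      also have "\<dots> = (\<Sum>v\<in>Hit n U. ennreal ((1 / real d) ^ n))"
        using cyl(2) by (intro sum.cong) auto
      also have "\<dots> = ennreal (real (card (Hit n U)) * (1 / real d) ^ n)"
        by (simp add: ennreal_mult ennreal_of_nat_eq_real_of_nat)
      also have "\<dots> \<le> ennreal (4 * (1 / real d) ^ n)"
      proof (intro ennreal_leI mult_right_mono)
        have "finite (Hit n U) \<and> card (Hit n U) \<le> 4"
        proof (rule card_separated_hits_le[of "C * \<rho> ^ n" U _ x])
          show "0 < C * \<rho> ^ n" using C \<rho> by simp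
          show "C * \<rho> ^ n \<le> \<bar>x u - x v\<bar>" if "u \<in> Hit n U" "v \<in> Hit n U" "u \<noteq> v" for u v
            using sep[of u v] that by (auto simp: Hit_def)
        qed (use U in \<open>auto simp: Hit_def\<close>)
        then show "real (card (Hit n U)) \<le> 4" by simp
      qed simp
      finally show ?thesis .
    qed
    \<comment> \<open>The factor 4 bounds the number of cells that are hit; the power of \<open>C * \<rho>\<close> compares the scale
      \<open>C * \<rho> ^ n\<close> with the diameter, which is larger than \<open>C * \<rho> ^ Suc n\<close>.\<close>
    define \<kappa> where "\<kappa> = 4 * (C * \<rho>) powr (- t)"
    have \<kappa>: "0 < \<kappa>" using C \<rho> by (simp add: \<kappa>_def)
    have Bd: "emeasure P (B U) \<le> ennreal \<kappa> * diam_pow t U"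
      if U: "bounded U" "diameter U \<le> C" for U
    proof -
      consider "U = {}" | "U \<noteq> {}" "t = 0" | "U \<noteq> {}" "0 < t" "diameter U = 0"
        | "U \<noteq> {}" "0 < t" "0 < diameter U"
        using t(1) diameter_ge_0[OF U(1)] by linarith
      then show ?thesis
      proof cases
        case 1
        then have "B U = {}" by (simp add: B_def Hit_def)
        then show ?thesis by simp
      next
        case 2
        then have "ennreal \<kappa> * diam_pow t U = ennreal 4"
          using C \<rho> by (simp add: diam_pow_def \<kappa>_def)
        moreover have "emeasure P (B U) \<le> 1" by (rule P.measure_le_1)
        moreover have "(1::ennreal) \<le> ennreal 4"
          by (metis ennreal_1 ennreal_leI one_le_numeral)
        ultimately show ?thesis by order
      next
        case 3
        \<comment> \<open>A single point has weight 0 for positive \<open>t\<close>, and it is met by at most four cells of every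
          generation.\<close>
        have "(\<lambda>n. ennreal (4 * (1 / real d) ^ n)) \<longlonglongrightarrow> ennreal (4 * 0)"
          using d by (intro tendsto_intros tendsto_ennrealI LIMSEQ_realpow_zero) auto
        moreover have "emeasure P (B U) \<le> ennreal (4 * (1 / real d) ^ n)" for n
          using 3 U C \<rho> by (intro B4) auto
        ultimately have "emeasure P (B U) \<le> ennreal (4 * 0)"
          by (intro LIMSEQ_le_const) auto
        then show ?thesis by simp
      next
        case 4
        obtain n where n: "C * \<rho> ^ Suc n < diameter U" "diameter U \<le> C * \<rho> ^ n"
          using geometric_scale[OF \<rho> 4(3) U(2)] .
        have "(1 / real d) ^ n = (\<rho> ^ n) powr s"
          using \<rho> by (simp flip: \<rho>s powr_realpow add: powr_powr mult.commute)
        also have "\<dots> \<le> (\<rho> ^ n) powr t"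
          using \<rho> ts by (intro powr_mono') (auto simp: power_le_one)
        also have "\<dots> = (C * \<rho>) powr (- t) * (C * \<rho> ^ Suc n) powr t"
          using \<rho> C by (simp add: powr_mult powr_minus field_simps)
        also have "\<dots> \<le> (C * \<rho>) powr (- t) * diameter U powr t"
          using n(1) C \<rho> t(1) by (intro mult_left_mono powr_mono2) auto
        finally have "4 * (1 / real d) ^ n \<le> \<kappa> * diameter U powr t"
          by (simp add: \<kappa>_def)
        then have "ennreal (4 * (1 / real d) ^ n) \<le> ennreal \<kappa> * diam_pow t U"
          using 4 \<kappa> by (simp add: diam_pow_def ennreal_leI flip: ennreal_mult)
        then show ?thesis using B4[OF U(1) n(2)] by order
      qed
    qed
    have "hausdorff_premeasure t C A \<le> hausdorff_measure t A"
      unfolding hausdorff_measure_def using C by (intro SUP_upper) simp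
    then have "hausdorff_premeasure t C A < ennreal (1 / \<kappa>)"
      using t(2) \<kappa> by simp
    then obtain U where U: "A \<subseteq> (\<Union>n. U n)" "\<And>n. bounded (U n) \<and> diameter (U n) \<le> C"
      "(\<Sum>n. diam_pow t (U n)) < ennreal (1 / \<kappa>)"
      unfolding hausdorff_premeasure_def Inf_less_iff by blast
    have "space P \<subseteq> (\<Union>i. B (U i))"
    proof
      fix z assume z: "z \<in> space P"
      then have "\<forall>i. z i < d" by (simp add: spaceP)
      then obtain y where y: "y \<in> A"
        "\<forall>n. x (map z [0..<n]) \<le> y \<and> y \<le> x (map z [0..<n]) + C * \<rho> ^ n"
        using pt by blast
      then obtain i where "y \<in> U i" using U(1) by blast
      then have "z \<in> B (U i)" using z y(2) by (auto simp: B_def Hit_def spaceP)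
      then show "z \<in> (\<Union>i. B (U i))" by blast
    qed
    then have "emeasure P (space P) \<le> emeasure P (\<Union>i. B (U i))"
      using Bsets by (intro emeasure_mono) auto
    also have "\<dots> \<le> (\<Sum>i. emeasure P (B (U i)))"
      using Bsets by (intro emeasure_subadditive_countably) auto
    also have "\<dots> \<le> (\<Sum>i. ennreal \<kappa> * diam_pow t (U i))"
      using Bd U(2) by (intro suminf_le) auto
    also have "\<dots> = ennreal \<kappa> * (\<Sum>i. diam_pow t (U i))"
      by (rule ennreal_suminf_cmult)
    also have "\<dots> < ennreal \<kappa> * ennreal (1 / \<kappa>)"
      using U(3) \<kappa> by (intro ennreal_mult_strict_left_mono) auto
    also have "\<dots> = 1" using \<kappa> by (simp flip: ennreal_mult)
    finally show False by (simp add: P.emeasure_space_1)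
  qed
  then show "ereal (ln (real d) / ln (1 / \<rho>)) \<le> ereal t" by (simp add: s_def)
qed

section \<open>Labelled trees and their regular subtrees\<close>

definition words :: "nat \<Rightarrow> nat \<Rightarrow> nat list set" where
  "words M n = {v. set v \<subseteq> {1..M} \<and> length v = n}"

text \<open>
  A labelled tree assigns a label to each word over \<open>{1..M}\<close>. The label of a nonempty word belongs
  to the edge that leads to this node; the label of the empty word has no meaning, which is why
  \<open>nodes\<close> excludes it.
\<close>
definition nodes :: "nat \<Rightarrow> nat list set" where
  "nodes M = {v. set v \<subseteq> {1..M} \<and> v \<noteq> []}"

definition subtree :: "(nat list \<Rightarrow> 'l) \<Rightarrow> nat list \<Rightarrow> nat list \<Rightarrow> 'l" where
  "subtree x w = (\<lambda>u. x (w @ u))"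

fun path_labels :: "(nat list \<Rightarrow> 'l) \<Rightarrow> nat list \<Rightarrow> 'l list" where
  "path_labels x [] = []"
| "path_labels x (i # v) = x [i] # path_labels (subtree x [i]) v"

lemma subtree_Nil [simp]: "subtree x [] = x"
  by (simp add: subtree_def)

lemma subtree_subtree [simp]: "subtree (subtree x u) v = subtree x (u @ v)"
  by (simp add: subtree_def)

lemma length_path_labels [simp]: "length (path_labels x v) = length v"
  by (induction v arbitrary: x) auto

lemma path_labels_append: "path_labels x (u @ v) = path_labels x u @ path_labels (subtree x u) v"
  by (induction u arbitrary: x) auto

lemma path_labels_cong:
  assumes "\<And>u. u \<in> nodes M \<Longrightarrow> length u \<le> length v \<Longrightarrow> x u = y u" "set v \<subseteq> {1..M}"
  shows "path_labels x v = path_labels y v"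
  using assms
proof (induction v arbitrary: x y)
  case (Cons i v)
  have "path_labels (subtree x [i]) v = path_labels (subtree y [i]) v"
    using Cons.prems by (intro Cons.IH) (auto simp: subtree_def nodes_def)
  then show ?case using Cons.prems(1)[of "[i]"] Cons.prems(2) by (simp add: nodes_def)
qed simp

lemma set_path_labels:
  assumes "\<And>u. u \<in> nodes M \<Longrightarrow> x u \<in> A" "set v \<subseteq> {1..M}"
  shows "set (path_labels x v) \<subseteq> A"
  using assms
proof (induction v arbitrary: x)
  case (Cons i v)
  have "set (path_labels (subtree x [i]) v) \<subseteq> A"
    using Cons.prems by (intro Cons.IH) (auto simp: subtree_def nodes_def)
  then show ?case using Cons.prems(1)[of "[i]"] Cons.prems(2) by (simp add: nodes_def)
qed simp

lemma finite_words [simp]: "finite (words M n)"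
  using finite_lists_length_eq[of "{1..M}" n] by (simp add: words_def)

lemma card_words: "card (words M n) = M ^ n"
  using card_lists_length_eq[of "{1..M}" n] by (simp add: words_def)

lemma path_labels_conv_map: "path_labels x v = map (\<lambda>k. x (take k v)) [1..<Suc (length v)]"
proof (induction v arbitrary: x)
  case (Cons i v)
  have "[1..<Suc (length (i # v))] = 1 # map Suc [1..<Suc (length v)]"
    by (simp add: map_Suc_upt upt_conv_Cons del: upt_Suc)
  then show ?case by (simp add: Cons subtree_def del: upt_Suc)
qed simp

text \<open>
  The tree contains \<open>j\<close> generations of a \<open>d\<close>-ary tree, \<open>k\<close> levels of the tree
  for each, such that the children of a vertex are reached along different label words.
\<close>
primrec regular :: "nat \<Rightarrow> nat \<Rightarrow> nat \<Rightarrow> nat \<Rightarrow> (nat list \<Rightarrow> 'l) \<Rightarrow> bool" where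
  "regular M k d 0 x = True"
| "regular M k d (Suc j) x = (\<exists>B\<subseteq>words M k. card B = d \<and> inj_on (path_labels x) B \<and>
      (\<forall>v\<in>B. regular M k d j (subtree x v)))"

lemma regular_Suc: "regular M k d (Suc j) x \<Longrightarrow> regular M k d j x"
proof (induction j arbitrary: x)
  case (Suc j)
  obtain B where B: "B \<subseteq> words M k" "card B = d" "inj_on (path_labels x) B"
    "\<And>v. v \<in> B \<Longrightarrow> regular M k d (Suc j) (subtree x v)"
    using Suc.prems unfolding regular.simps(2)[of M k d "Suc j"] by blast
  have "regular M k d j (subtree x v)" if "v \<in> B" for v
    using Suc.IH B(4)[OF that] .
  with B(1,2,3) show ?case unfolding regular.simps(2)[of M k d j] by blast
qed simp

lemma regular_antimono: "i \<le> j \<Longrightarrow> regular M k d j x \<Longrightarrow> regular M k d i x"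
  by (induction rule: inc_induct) (auto dest: regular_Suc simp del: regular.simps)

text \<open>
  A compactness argument: for every \<open>j\<close> there is a set of \<open>d\<close> children that are regular to depth
  \<open>j\<close>. There are only finitely many candidates for this set, so one of them serves for infinitely
  many \<open>j\<close>, and then for all \<open>j\<close>, as regularity to a larger depth is the stronger property.
\<close>
lemma regular_all_children:
  assumes "\<And>j. regular M k d j x"
  obtains B where "B \<subseteq> words M k" "card B = d" "inj_on (path_labels x) B"
    "\<And>v j. v \<in> B \<Longrightarrow> regular M k d j (subtree x v)"
proof -
  have "\<forall>j. \<exists>B\<in>Pow (words M k). card B = d \<and> inj_on (path_labels x) B \<and>
      (\<forall>v\<in>B. regular M k d j (subtree x v))"
    using assms[of "Suc j" for j] by (simp add: Pow_def)
  then obtain f where f: "\<And>j. f j \<in> Pow (words M k)" "\<And>j. card (f j) = d"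
    "\<And>j. inj_on (path_labels x) (f j)" "\<And>j v. v \<in> f j \<Longrightarrow> regular M k d j (subtree x v)"
    by metis
  have "finite (range f)"
    by (rule finite_subset[of _ "Pow (words M k)"]) (use f(1) in auto)
  then obtain j0 where j0: "infinite {j. f j = f j0}"
    using pigeonhole_infinite[of UNIV f] by (auto simp: infinite_UNIV_nat)
  show ?thesis
  proof (rule that[of "f j0"])
    fix v j assume v: "v \<in> f j0"
    obtain i where i: "j < i" "f i = f j0"
      using j0 unfolding infinite_nat_iff_unbounded by blast
    then have "regular M k d i (subtree x v)" using f(4)[of v i] v by simp
    then show "regular M k d j (subtree x v)" using i(1) by (intro regular_antimono[of j i]) auto
  qed (use f in auto)
qed

text \<open>
  An enumeration of \<open>d\<close> children as in \<open>regular_all_children\<close>. Iterating it (\<open>address\<close>) embeds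
  the full \<open>d\<close>-ary tree, whose vertices are words of digits below \<open>d\<close>.
\<close>
definition child :: "nat \<Rightarrow> nat \<Rightarrow> nat \<Rightarrow> (nat list \<Rightarrow> 'l) \<Rightarrow> nat \<Rightarrow> nat list" where
  "child M k d x = (SOME e. inj_on (path_labels x \<circ> e) {..<d} \<and>
     (\<forall>i<d. e i \<in> words M k \<and> (\<forall>j. regular M k d j (subtree x (e i)))))"

lemma child_spec:
  assumes "\<And>j. regular M k d j x"
  shows "inj_on (path_labels x \<circ> child M k d x) {..<d}"
    and "i < d \<Longrightarrow> child M k d x i \<in> words M k"
    and "i < d \<Longrightarrow> regular M k d j (subtree x (child M k d x i))"
proof -
  obtain B where B: "B \<subseteq> words M k" "card B = d" "inj_on (path_labels x) B"
    "\<And>v j. v \<in> B \<Longrightarrow> regular M k d j (subtree x v)"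
    using regular_all_children[of M k d x] assms by blast
  have "finite B" using B(1) by (rule finite_subset) simp
  then obtain e where e: "bij_betw e {..<d} B"
    using bij_betw_from_nat_into_finite[of B] B(2) by blast
  have "\<exists>e. inj_on (path_labels x \<circ> e) {..<d} \<and>
     (\<forall>i<d. e i \<in> words M k \<and> (\<forall>j. regular M k d j (subtree x (e i))))"
  proof (intro exI[of _ e] conjI allI impI)
    show "inj_on (path_labels x \<circ> e) {..<d}"
      using e B(3) by (intro comp_inj_on) (auto simp: bij_betw_def)
  qed (use bij_betwE[OF e] B in auto)
  from someI_ex[OF this]
  have "inj_on (path_labels x \<circ> child M k d x) {..<d} \<and> (\<forall>i<d. child M k d x i \<in> words M k \<and>
     (\<forall>j. regular M k d j (subtree x (child M k d x i))))"
    unfolding child_def[symmetric] .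
  then show "inj_on (path_labels x \<circ> child M k d x) {..<d}"
    "i < d \<Longrightarrow> child M k d x i \<in> words M k"
    "i < d \<Longrightarrow> regular M k d j (subtree x (child M k d x i))" by auto
qed

fun address :: "nat \<Rightarrow> nat \<Rightarrow> nat \<Rightarrow> (nat list \<Rightarrow> 'l) \<Rightarrow> nat list \<Rightarrow> nat list" where
  "address M k d x [] = []"
| "address M k d x (i # z) = child M k d x i @ address M k d (subtree x (child M k d x i)) z"

lemma address_append:
  "address M k d x (z @ z') = address M k d x z @ address M k d (subtree x (address M k d x z)) z'"
  by (induction z arbitrary: x) auto

lemma address_in_words:
  assumes "\<And>j. regular M k d j x" "set z \<subseteq> {..<d}"
  shows "address M k d x z \<in> words M (k * length z)"
  using assms
proof (induction z arbitrary: x)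
  case (Cons i z)
  have "address M k d (subtree x (child M k d x i)) z \<in> words M (k * length z)"
  proof (rule Cons.IH)
    show "regular M k d j (subtree x (child M k d x i))" for j
      using child_spec(3)[OF Cons.prems(1)] Cons.prems(2) by simp
  qed (use Cons.prems(2) in simp)
  then show ?case using child_spec(2)[OF Cons.prems(1), of i] Cons.prems(2) by (auto simp: words_def)
qed (simp add: words_def)

text \<open>
  Two codes are told apart by the first block in which they differ, since the blocks of label words
  all have length \<open>k\<close> and siblings have different blocks.
\<close>
lemma path_labels_address_inj:
  assumes "\<And>j. regular M k d j x" "set z \<subseteq> {..<d}" "set z' \<subseteq> {..<d}" "length z = length z'"
    "path_labels x (address M k d x z) = path_labels x (address M k d x z')"
  shows "z = z'"
  using assms
proof (induction z arbitrary: x z')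
  case (Cons i z)
  then obtain i' y where z': "z' = i' # y" by (cases z') auto
  have len: "length (child M k d x i) = length (child M k d x i')"
    using child_spec(2)[OF Cons.prems(1), of i] child_spec(2)[OF Cons.prems(1), of i'] Cons.prems z'
    by (auto simp: words_def)
  have eq: "path_labels x (child M k d x i) = path_labels x (child M k d x i')"
    "path_labels (subtree x (child M k d x i)) (address M k d (subtree x (child M k d x i)) z) =
     path_labels (subtree x (child M k d x i')) (address M k d (subtree x (child M k d x i')) y)"
    using Cons.prems(5) len by (simp_all add: z' path_labels_append)
  have "i = i'"
    using inj_onD[OF child_spec(1)[OF Cons.prems(1)], of i i'] eq(1) Cons.prems z' by auto
  moreover have "z = y"
    using Cons.prems z' eq(2) child_spec(3)[OF Cons.prems(1), of i] \<open>i = i'\<close> by (intro Cons.IH) auto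
  ultimately show ?case by (simp add: z')
qed simp

lemma prefix_chain_limit:
  fixes V :: "nat \<Rightarrow> 'a list"
  assumes step: "\<And>n. \<exists>e. V (Suc n) = V n @ e" and len: "\<And>n. n \<le> length (V n)"
  obtains u where "\<And>n. V n = map u [0..<length (V n)]"
proof -
  have pre: "\<exists>e. V n = V m @ e" if "m \<le> n" for m n
    using that
  proof (induction rule: dec_induct)
    case (step n)
    then show ?case using assms(1)[of n] by (metis append.assoc)
  qed simp
  have nth: "V n ! i = V m ! i" if "i < length (V n)" "i < length (V m)" for n m i
  proof -
    have "V n ! i = V m ! i" if "m \<le> n" "i < length (V m)" for n m
      using pre[OF that(1)] that(2) by (auto simp: nth_append)
    then show ?thesis using that linear[of m n] by metis
  qed
  show ?thesis
  proof (rule that)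
    fix n
    show "V n = map (\<lambda>i. V (Suc i) ! i) [0..<length (V n)]"
      using len[of "Suc i" for i] by (intro nth_equalityI) (auto simp: Suc_le_eq intro!: nth)
  qed
qed

lemma le_card_image_iff:
  assumes "finite A"
  shows "h \<le> card (f ` A) \<longleftrightarrow> (\<exists>B\<subseteq>A. card B = h \<and> inj_on f B)"
proof
  assume "h \<le> card (f ` A)"
  then obtain C where C: "C \<subseteq> f ` A" "card C = h" by (meson obtain_subset_with_card_n)
  then obtain B where "B \<subseteq> A" "inj_on f B" "C = f ` B" by (auto simp: subset_image_inj)
  then show "\<exists>B\<subseteq>A. card B = h \<and> inj_on f B" using C card_image by metis
next
  assume "\<exists>B\<subseteq>A. card B = h \<and> inj_on f B"
  then obtain B where B: "B \<subseteq> A" "card B = h" "inj_on f B" by blast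
  have "card (f ` B) \<le> card (f ` A)" using B(1) assms by (intro card_mono) auto
  then show "h \<le> card (f ` A)" using B card_image by metis
qed

definition level_count :: "nat \<Rightarrow> nat \<Rightarrow> (nat list \<Rightarrow> 'l) \<Rightarrow> nat" where
  "level_count M k x = card (path_labels x ` words M k)"

text \<open>
  The number of label words is at least \<open>h\<close> exactly if this collection has a member with \<open>h\<close>
  elements. In contrast to the count, the collection determines which representatives to choose,
  and it takes only finitely many values, so that conditioning on it is elementary.
\<close>
definition distinct_families :: "nat \<Rightarrow> nat \<Rightarrow> (nat list \<Rightarrow> 'l) \<Rightarrow> nat list set set" where
  "distinct_families M k x = {B \<in> Pow (words M k). inj_on (path_labels x) B}"

lemma level_count_ge_iff:
  "h \<le> level_count M k x \<longleftrightarrow> (\<exists>B\<in>distinct_families M k x. card B = h)"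
  unfolding level_count_def distinct_families_def by (subst le_card_image_iff) auto

lemma level_count_bounds: "1 \<le> M \<Longrightarrow> 1 \<le> level_count M k x" "level_count M k x \<le> M ^ k"
proof -
  show "level_count M k x \<le> M ^ k"
    using card_image_le[of "words M k" "path_labels x"] by (simp add: level_count_def card_words)
  assume "1 \<le> M"
  then have "card (words M k) \<noteq> 0" by (simp add: card_words)
  then have "words M k \<noteq> {}" by auto
  then have "0 < level_count M k x" unfolding level_count_def by (subst card_gt_0_iff) auto
  then show "1 \<le> level_count M k x" by simp
qed

section \<open>The limit set of a labelled tree\<close>

primrec word_map :: "real \<Rightarrow> (nat \<Rightarrow> real) \<Rightarrow> nat list \<Rightarrow> real \<Rightarrow> real" where
  "word_map r b [] y = y"
| "word_map r b (i # l) y = ifs_map r b i (word_map r b l y)"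

text \<open>
  The random set expressed by the labelled tree alone: the points that lie in all cells along some
  infinite path.
\<close>
definition limit_set :: "nat \<Rightarrow> real \<Rightarrow> (nat \<Rightarrow> real) \<Rightarrow> (nat list \<Rightarrow> nat) \<Rightarrow> real set" where
  "limit_set M r b x = {y. \<exists>u. (\<forall>n. u n \<in> {1..M}) \<and>
     (\<forall>n. y \<in> word_map r b (path_labels x (map u [0..<Suc n])) ` {0..1})}"

lemma word_map_affine: "word_map r b l y = word_map r b l 0 + r ^ length l * y"
  by (induction l) (auto simp: ifs_map_def algebra_simps)

lemma word_map_append: "word_map r b (l @ l') y = word_map r b l (word_map r b l' y)"
  by (induction l) auto

lemma word_map_image:
  assumes "0 < r"
  shows "word_map r b l ` {0..1} = {word_map r b l 0 .. word_map r b l 0 + r ^ length l}"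
proof -
  have "word_map r b l ` {0..1} = (\<lambda>y. r ^ length l * y + word_map r b l 0) ` {0..1}"
    by (intro image_cong refl) (subst word_map_affine, simp)
  also have "\<dots> = {word_map r b l 0 .. word_map r b l 0 + r ^ length l}"
    using assms by (subst image_affinity_atLeastAtMost) (auto simp: add.commute)
  finally show ?thesis .
qed

text \<open>
  The assumptions on the interval maps in terms of their parameters: the images of \<open>[0, 1]\<close> are
  contained in \<open>[0, 1]\<close> and follow each other from left to right.
\<close>
locale ordered_ifs =
  fixes N :: nat and r :: real and b :: "nat \<Rightarrow> real"
  assumes r0: "0 < r" and r1: "r < 1"
    and b0: "\<And>i. i \<in> {1..N} \<Longrightarrow> 0 \<le> b i"
    and b1: "\<And>i. i \<in> {1..N} \<Longrightarrow> b i + r \<le> 1"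
    and bsep: "\<And>i j. i \<in> {1..N} \<Longrightarrow> j \<in> {1..N} \<Longrightarrow> i < j \<Longrightarrow> b i + r \<le> b j"
begin

lemma word_map_bounds:
  "set l \<subseteq> {1..N} \<Longrightarrow> 0 \<le> word_map r b l 0 \<and> word_map r b l 0 + r ^ length l \<le> 1"
proof (induction l)
  case (Cons i l)
  then have IH: "0 \<le> word_map r b l 0" "word_map r b l 0 + r ^ length l \<le> 1"
    and i: "0 \<le> b i" "b i + r \<le> 1" using b0 b1 by auto
  have "0 \<le> r * word_map r b l 0" using IH(1) r0 by simp
  moreover have "r * (word_map r b l 0 + r ^ length l) \<le> r * 1"
    using IH(2) r0 by (intro mult_left_mono) auto
  ultimately show ?case using i by (auto simp: ifs_map_def algebra_simps)
qed simp

text \<open>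
  After the common prefix is stripped off, the two cells lie in the images of different maps, the
  right one of which starts beyond the end of the left one. As a cell of length \<open>r ^ length l\<close> fits
  between its own left end point and that end, the left end points are at least this far apart.
\<close>
lemma word_map_separated:
  assumes "length l = length l'" "set l \<subseteq> {1..N}" "set l' \<subseteq> {1..N}" "l \<noteq> l'"
  shows "r ^ length l \<le> \<bar>word_map r b l 0 - word_map r b l' 0\<bar>"
  using assms
proof (induction l arbitrary: l')
  case (Cons i l)
  then obtain i' h where l': "l' = i' # h" by (cases l') auto
  have lt: "r * r ^ length v \<le> word_map r b (j # w) 0 - word_map r b (i # v) 0"
    if "i < j" "set (i # v) \<subseteq> {1..N}" "set (j # w) \<subseteq> {1..N}" for i j v w
  proof -
    have "b i + r \<le> b j" using that by (intro bsep) auto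
    moreover have "r * (word_map r b v 0 + r ^ length v) \<le> r * 1"
      using word_map_bounds[of v] that r0 by (intro mult_left_mono) auto
    moreover have "0 \<le> r * word_map r b w 0"
      using word_map_bounds[of w] that r0 by auto
    ultimately show ?thesis by (simp add: ifs_map_def algebra_simps)
  qed
  consider "i < i'" | "i' < i" | "i = i'" "l \<noteq> h" using Cons.prems l' by fastforce
  then show ?case
  proof cases
    case 1
    with lt[of i i' l h] Cons.prems l' show ?thesis by simp
  next
    case 2
    with lt[of i' i h l] Cons.prems l' show ?thesis by simp
  next
    case 3
    then have "r ^ length l \<le> \<bar>word_map r b l 0 - word_map r b h 0\<bar>"
      using Cons.prems l' by (intro Cons.IH) auto
    then have "r * r ^ length l \<le> r * \<bar>word_map r b l 0 - word_map r b h 0\<bar>"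
      using r0 by simp
    also have "\<dots> = \<bar>r * word_map r b l 0 - r * word_map r b h 0\<bar>"
      using r0 by (simp add: abs_mult flip: right_diff_distrib)
    finally show ?thesis using 3 l' by (simp add: ifs_map_def)
  qed
qed simp

lemma word_map_append_bounds:
  assumes "set l' \<subseteq> {1..N}"
  shows "word_map r b l 0 \<le> word_map r b (l @ l') 0"
    and "word_map r b (l @ l') 0 + r ^ length (l @ l') \<le> word_map r b l 0 + r ^ length l"
proof -
  have "r ^ length l * (word_map r b l' 0 + r ^ length l') \<le> r ^ length l * 1"
    using word_map_bounds[OF assms] r0 by (intro mult_left_mono) auto
  then show "word_map r b (l @ l') 0 + r ^ length (l @ l') \<le> word_map r b l 0 + r ^ length l"
    by (simp add: word_map_append word_map_affine[of r b l "word_map r b l' 0"] algebra_simps power_add)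
  show "word_map r b l 0 \<le> word_map r b (l @ l') 0"
    using word_map_bounds[OF assms] r0
    by (simp add: word_map_append word_map_affine[of r b l "word_map r b l' 0"])
qed

lemma path_point:
  assumes x: "\<And>u. u \<in> nodes M \<Longrightarrow> x u \<in> {1..N}" and u: "\<And>n. u n \<in> {1..M}"
  obtains y where "\<And>n. y \<in> word_map r b (path_labels x (map u [0..<n])) ` {0..1}"
proof -
  define I where "I n = word_map r b (path_labels x (map u [0..<n])) ` {0..1}" for n
  have anti: "I n \<subseteq> I m" if "m \<le> n" for m n
  proof -
    define l where "l = path_labels (subtree x (map u [0..<m])) (map u [m..<n])"
    have "map u [0..<n] = map u [0..<m] @ map u [m..<n]"
      using upt_add_eq_append[of 0 m "n - m"] that by (simp flip: map_append)
    then have "path_labels x (map u [0..<n]) = path_labels x (map u [0..<m]) @ l"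
      by (simp add: path_labels_append l_def)
    moreover have "set l \<subseteq> {1..N}"
      unfolding l_def
    proof (rule set_path_labels[of M])
      fix v assume v: "v \<in> nodes M"
      have "map u [0..<m] @ v \<in> nodes M" using v u by (auto simp: nodes_def simp del: atLeastAtMost_iff)
      then show "subtree x (map u [0..<m]) v \<in> {1..N}" using x by (simp add: subtree_def)
    qed (use u in auto)
    ultimately show ?thesis
      unfolding I_def using word_map_append_bounds[of l "path_labels x (map u [0..<m])"]
      by (simp add: word_map_image[OF r0] del: length_append)
  qed
  have "(\<Inter>n. I n) \<noteq> {}"
  proof (rule compact_nest)
    show "compact (I n)" "I n \<noteq> {}" for n
      using r0 by (auto simp: I_def word_map_image[OF r0])
  qed (use anti in auto)
  then show ?thesis using that unfolding I_def by blast
qed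

text \<open>
  A sequence of digits below \<open>d\<close> determines an infinite path that starts at the root, passes through
  \<open>w\<close> and then follows the addresses. The cells along this path are those of the coding to which
  \<open>hausdorff_dim_ge_regular_tree\<close> applies, with ratio \<open>r ^ k\<close> and initial length
  \<open>r ^ length w\<close>.
\<close>
lemma hausdorff_dim_limit_set_ge:
  assumes x: "\<And>u. u \<in> nodes M \<Longrightarrow> x u \<in> {1..N}" and w: "set w \<subseteq> {1..M}"
    and reg: "\<And>j. regular M k d j (subtree x w)" and k: "0 < k" and d: "1 < d"
  shows "ereal (ln (real d) / (real k * ln (1 / r))) \<le> hausdorff_dim (limit_set M r b x)"
proof -
  define V where "V z = w @ address M k d (subtree x w) z" for z
  have cw: "address M k d (subtree x w) z \<in> words M (k * length z)" if "set z \<subseteq> {..<d}" for z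
    using address_in_words[OF reg that] .
  have V: "set (V z) \<subseteq> {1..M}" "length (V z) = length w + k * length z" if "set z \<subseteq> {..<d}" for z
    using cw[OF that] w by (auto simp: V_def words_def)
  define l where "l z = path_labels x (V z)" for z
  have l: "set (l z) \<subseteq> {1..N}" "length (l z) = length w + k * length z" if "set z \<subseteq> {..<d}" for z
    using set_path_labels[of M x "{1..N}" "V z"] x V[OF that] by (auto simp: l_def)
  have "ereal (ln (real d) / ln (1 / r ^ k)) \<le> hausdorff_dim (limit_set M r b x)"
  proof (rule hausdorff_dim_ge_regular_tree[where C = "r ^ length w" and x = "\<lambda>z. word_map r b (l z) 0"])
    show "1 < d" by (rule d)
    show "0 < r ^ k" "0 < r ^ length w" using r0 by auto
    show "r ^ k < 1" using r0 r1 k by (simp add: power_Suc_less_one power_less_one_iff)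
  next
    fix u v assume uv: "length u = length v" "set u \<subseteq> {..<d}" "set v \<subseteq> {..<d}" "u \<noteq> v"
    have "l u \<noteq> l v"
      using path_labels_address_inj[OF reg uv(2,3,1)] uv(4)
      by (auto simp: l_def V_def path_labels_append)
    then have "r ^ length (l u) \<le> \<bar>word_map r b (l u) 0 - word_map r b (l v) 0\<bar>"
      using uv l by (intro word_map_separated) auto
    then show "r ^ length w * (r ^ k) ^ length u \<le> \<bar>word_map r b (l u) 0 - word_map r b (l v) 0\<bar>"
      using l(2)[OF uv(2)] by (simp add: power_add power_mult)
  next
    fix z :: "nat \<Rightarrow> nat" assume z: "\<forall>i. z i < d"
    define Z where "Z n = V (map z [0..<n])" for n
    have zs: "set (map z [0..<n]) \<subseteq> {..<d}" for n using z by auto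
    have lenZ: "length (Z n) = length w + k * n" for n
      using V(2)[OF zs] by (simp add: Z_def)
    have "\<exists>e. Z (Suc n) = Z n @ e" for n by (simp add: Z_def V_def address_append)
    moreover have "n \<le> length (Z n)" for n unfolding lenZ using k by (simp add: trans_le_add2)
    ultimately obtain u where u: "\<And>n. Z n = map u [0..<length (Z n)]"
      using prefix_chain_limit[of Z] by blast
    have uM: "u n \<in> {1..M}" for n
    proof -
      have "n < length w + k * Suc n" using k by (cases k) auto
      then have "u n \<in> set (map u [0..<length (Z (Suc n))])" unfolding lenZ by simp
      then have "u n \<in> set (Z (Suc n))" using u[of "Suc n"] by simp
      then show ?thesis using V(1)[OF zs, of "Suc n"] unfolding Z_def by blast
    qed
    obtain y where y: "\<And>n. y \<in> word_map r b (path_labels x (map u [0..<n])) ` {0..1}"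
      using path_point[of M x u] x uM by blast
    show "\<exists>y\<in>limit_set M r b x. \<forall>n. word_map r b (l (map z [0..<n])) 0 \<le> y \<and>
        y \<le> word_map r b (l (map z [0..<n])) 0 + r ^ length w * (r ^ k) ^ n"
    proof (intro bexI[of _ y] allI)
      show "y \<in> limit_set M r b x" using y uM unfolding limit_set_def by blast
      fix n
      have "y \<in> word_map r b (l (map z [0..<n])) ` {0..1}"
        using y[of "length (Z n)"] u[of n] by (simp add: l_def Z_def)
      then show "word_map r b (l (map z [0..<n])) 0 \<le> y \<and>
        y \<le> word_map r b (l (map z [0..<n])) 0 + r ^ length w * (r ^ k) ^ n"
        using l(2)[OF zs, of n] by (simp add: word_map_image[OF r0] power_add power_mult)
    qed
  qed
  moreover have "ln (1 / r ^ k) = real k * ln (1 / r)"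
    using r0 by (simp add: ln_div ln_realpow)
  ultimately show ?thesis by simp
qed

lemma limit_set_subset_cells:
  assumes "0 < n"
  shows "limit_set M r b x \<subseteq> (\<Union>l\<in>path_labels x ` words M n. word_map r b l ` {0..1})"
proof
  fix y assume "y \<in> limit_set M r b x"
  then obtain u where u: "\<And>n. u n \<in> {1..M}"
    "\<And>n. y \<in> word_map r b (path_labels x (map u [0..<Suc n])) ` {0..1}"
    unfolding limit_set_def by blast
  have "map u [0..<n] \<in> words M n" using u(1) by (auto simp: words_def)
  moreover have "y \<in> word_map r b (path_labels x (map u [0..<n])) ` {0..1}"
    using u(2)[of "n - 1"] assms by simp
  ultimately show "y \<in> (\<Union>l\<in>path_labels x ` words M n. word_map r b l ` {0..1})" by blast
qed

lemma limit_set_cover: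
  fixes x :: "nat list \<Rightarrow> nat" and M :: nat
  assumes n: "0 < n" and \<delta>: "r ^ n \<le> \<delta>"
  defines "C \<equiv> (\<lambda>l. word_map r b l ` {0..1}) ` path_labels x ` words M n"
  shows "finite C" "limit_set M r b x \<subseteq> \<Union>C" "\<forall>U\<in>C. bounded U \<and> diameter U \<le> \<delta>"
    "card C \<le> card (path_labels x ` words M n)"
proof -
  show "finite C" "card C \<le> card (path_labels x ` words M n)"
    unfolding C_def by (auto intro!: card_image_le)
  show "limit_set M r b x \<subseteq> \<Union>C"
    using limit_set_subset_cells[OF n] unfolding C_def by blast
  show "\<forall>U\<in>C. bounded U \<and> diameter U \<le> \<delta>"
    unfolding C_def using \<delta> r0
    by (auto simp: word_map_image words_def less_imp_le)
qed

end

lemma branch_map_eq_word_map: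
  "branch_map M r b \<omega> u n =
     word_map r b (path_labels (edge_label M \<omega>) (map (\<lambda>i. u (Suc i)) [0..<n]))"
proof -
  have fold: "foldr (\<lambda>k g. ifs_map r b (f k) \<circ> g) ks id = word_map r b (map f ks)" for f and ks :: "nat list"
    by (induction ks) (auto simp: fun_eq_iff)
  have "path_labels (edge_label M \<omega>) (map (\<lambda>i. u (Suc i)) [0..<n]) =
      map (\<lambda>k. edge_label M \<omega> (word_prefix u k)) [1..<Suc n]"
  proof -
    have "take k (map (\<lambda>i. u (Suc i)) [0..<n]) = word_prefix u k" if "k \<in> set [1..<Suc n]" for k
    proof -
      have "take k (map (\<lambda>i. u (Suc i)) [0..<n]) = map u (map Suc [0..<k])"
        using that by (auto simp: take_map take_upt simp del: upt_Suc)
      also have "\<dots> = word_prefix u k" unfolding word_prefix_def map_Suc_upt by simp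
      finally show ?thesis .
    qed
    then show ?thesis unfolding path_labels_conv_map by (intro map_cong) (auto simp del: upt_Suc)
  qed
  then show ?thesis unfolding branch_map_def fold by simp
qed

lemma (in ordered_ifs) random_set_eq_limit_set:
  "random_set M r b \<omega> = limit_set M r b (edge_label M \<omega>)"
proof -
  define I where "I u n = word_map r b (path_labels (edge_label M \<omega>) (map u [0..<n])) ` {0..1}"
    for u :: "nat \<Rightarrow> nat" and n
  have uniq: "y = y'" if "\<And>n. y \<in> I u (Suc n)" "\<And>n. y' \<in> I u (Suc n)" for y y' u
  proof (rule ccontr)
    assume "y \<noteq> y'"
    then have "0 < \<bar>y - y'\<bar>" by simp
    then obtain n where n: "r ^ n < \<bar>y - y'\<bar>" using real_arch_pow_inv[of _ r] r1 by blast
    have "\<bar>y - y'\<bar> \<le> r ^ Suc n"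
      using that(1,2)[of n] unfolding I_def word_map_image[OF r0] by auto
    also have "\<dots> \<le> r ^ n" using r0 r1 by (simp add: mult_left_le_one_le)
    finally show False using n by simp
  qed
  have br: "branch_map M r b \<omega> u n ` {0..1} = I (\<lambda>i. u (Suc i)) n" for u n
    by (simp add: branch_map_eq_word_map I_def)
  show ?thesis
  proof (intro equalityI subsetI)
    fix y assume "y \<in> random_set M r b \<omega>"
    then obtain u where u: "u \<in> {1..} \<rightarrow>\<^sub>E {1..M}" "{y} = (\<Inter>n\<in>{1..}. I (\<lambda>i. u (Suc i)) n)"
      unfolding random_set_def br by blast
    then have "\<forall>n. y \<in> I (\<lambda>i. u (Suc i)) (Suc n)" by auto
    moreover have "\<forall>n. u (Suc n) \<in> {1..M}" using PiE_mem[OF u(1)] by simp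
    ultimately show "y \<in> limit_set M r b (edge_label M \<omega>)"
      unfolding limit_set_def I_def mem_Collect_eq
      by (intro exI[of _ "\<lambda>i. u (Suc i)"] conjI)
  next
    fix y assume "y \<in> limit_set M r b (edge_label M \<omega>)"
    then obtain v where v: "\<And>n. v n \<in> {1..M}" "\<And>n. y \<in> I v (Suc n)"
      unfolding limit_set_def I_def by blast
    define u where "u = (\<lambda>i\<in>{1..}. v (i - 1))"
    have vu: "(\<lambda>i. u (Suc i)) = v" by (auto simp: u_def)
    have "{y} = (\<Inter>n\<in>{1..}. I v n)"
    proof (intro equalityI subsetI)
      fix y' assume "y' \<in> {y}"
      moreover have "y \<in> I v n" if "1 \<le> n" for n
        using v(2)[of "n - 1"] that by simp
      ultimately show "y' \<in> (\<Inter>n\<in>{1..}. I v n)" by simp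
    next
      fix y' assume "y' \<in> (\<Inter>n\<in>{1..}. I v n)"
      then show "y' \<in> {y}" using uniq[of y' v y] v(2) by auto
    qed
    moreover have "u \<in> {1..} \<rightarrow>\<^sub>E {1..M}" using v(1) by (auto simp: u_def)
    ultimately show "y \<in> random_set M r b \<omega>"
      unfolding random_set_def br using vu by auto
  qed
qed

context ordered_ifs
begin

lemma ln_inverse_ratio: "0 < ln (1 / r)"
  using r0 r1 by simp

lemma limit_set_totally_bounded:
  assumes "0 < \<delta>"
  shows "\<exists>C. finite C \<and> limit_set M r b x \<subseteq> \<Union>C \<and> (\<forall>U\<in>C. bounded U \<and> diameter U \<le> \<delta>)"
proof -
  obtain n where "r ^ n < \<delta>" using real_arch_pow_inv[OF assms r1] by blast
  moreover have "r ^ Suc n \<le> r ^ n" using r0 r1 by (simp add: mult_left_le_one_le)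
  ultimately have "r ^ Suc n \<le> \<delta>" by simp
  from limit_set_cover[OF _ this, where M = M and x = x] show ?thesis by blast
qed

text \<open>
  The cells of generation \<open>n = \<lceil>ln \<delta> / ln r\<rceil>\<close> have length at most \<open>\<delta>\<close>. Rounding
  \<open>n\<close> up contributes the term \<open>\<tau> / - ln \<delta>\<close>, which vanishes as \<open>\<delta>\<close> tends to 0.
\<close>
lemma upper_box_dim_limit_set_le:
  fixes x :: "nat list \<Rightarrow> nat"
  assumes M: "1 \<le> M"
    and ev: "\<forall>\<^sub>F n in sequentially. real (level_count M n x) \<le> exp (\<tau> * real n)"
  shows "upper_box_dim (limit_set M r b x) \<le> ereal (\<tau> / ln (1 / r))"
proof -
  define l where "l = ln (1 / r)"
  have l: "0 < l" unfolding l_def by (rule ln_inverse_ratio)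
  obtain n0 where n0: "\<And>n. n0 \<le> n \<Longrightarrow> real (level_count M n x) \<le> exp (\<tau> * real n)"
    using ev by (auto simp: eventually_sequentially)
  have \<tau>: "0 \<le> \<tau>"
  proof -
    have "1 \<le> real (level_count M (Suc n0) x)" using level_count_bounds(1)[OF M] by simp
    also have "\<dots> \<le> exp (\<tau> * real (Suc n0))" using n0[of "Suc n0"] by simp
    finally have "0 \<le> \<tau> * real (Suc n0)" by (simp only: one_le_exp_iff)
    then show ?thesis by (simp add: zero_le_mult_iff)
  qed
  \<comment> \<open>Below this scale the generation \<open>n\<close> chosen for \<open>\<delta>\<close> is positive and at least \<open>n0\<close>.\<close>
  define \<delta>0 where "\<delta>0 = exp (- l * real (Suc n0))"
  have "\<forall>\<^sub>F \<delta> in at_right 0. 0 < \<delta> \<and> \<delta> < \<delta>0"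
    by (intro eventually_at_rightI[of 0 \<delta>0]) (auto simp: \<delta>0_def)
  then have le: "\<forall>\<^sub>F \<delta> in at_right 0.
      ereal (ln (real (covering_number \<delta> (limit_set M r b x))) / - ln \<delta>) \<le> ereal (\<tau> / l + \<tau> / - ln \<delta>)"
  proof eventually_elim
    case (elim \<delta>)
    then have "ln \<delta> < ln \<delta>0" by simp
    then have ln\<delta>: "l * real (Suc n0) < - ln \<delta>" by (simp add: \<delta>0_def)
    moreover have "0 < l * real (Suc n0)" using l by simp
    ultimately have pos: "0 < - ln \<delta>" by linarith
    define n where "n = nat \<lceil>- ln \<delta> / l\<rceil>"
    have n1: "- ln \<delta> / l \<le> real n" unfolding n_def by (rule real_nat_ceiling_ge)
    have n2: "real n \<le> - ln \<delta> / l + 1"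
    proof -
      have "0 < - ln \<delta> / l" using pos l by (rule divide_pos_pos)
      then show ?thesis unfolding n_def by linarith
    qed
    have "real (Suc n0) < - ln \<delta> / l" using ln\<delta> l by (simp add: field_simps)
    then have nn: "n0 \<le> n" "0 < n" using n1 by linarith+
    have "r ^ n \<le> \<delta>"
    proof -
      have "real n * ln r \<le> ln \<delta>" using n1 l r0 by (simp add: l_def ln_div field_simps)
      then have "ln (r ^ n) \<le> ln \<delta>" using r0 by (simp add: ln_realpow)
      then show ?thesis using r0 elim by (simp add: ln_le_cancel_iff)
    qed
    note cov = limit_set_cover[OF nn(2) this, where M = M and x = x]
    have "covering_number \<delta> (limit_set M r b x) \<le> level_count M n x"
      using covering_number_le[OF cov(1,2)] cov(3,4) unfolding level_count_def by (meson order_trans)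
    then have "real (covering_number \<delta> (limit_set M r b x)) \<le> exp (\<tau> * real n)"
      using n0[OF nn(1)] by linarith
    then have "ln (real (covering_number \<delta> (limit_set M r b x))) \<le> \<tau> * real n"
    proof (cases "covering_number \<delta> (limit_set M r b x) = 0")
      case False
      then show ?thesis
        using \<open>real (covering_number \<delta> (limit_set M r b x)) \<le> exp (\<tau> * real n)\<close>
        by (subst ln_exp[symmetric], subst ln_le_cancel_iff) auto
    qed (use \<tau> in simp)
    also have "\<dots> \<le> \<tau> * (- ln \<delta> / l + 1)" using n2 \<tau> by (rule mult_left_mono)
    also have "\<dots> = (\<tau> / l + \<tau> / - ln \<delta>) * - ln \<delta>" using pos l by (simp add: field_simps)
    finally show ?case using pos by (simp only: ereal_less_eq pos_divide_le_eq)
  qed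
  have "((\<lambda>\<delta>. \<tau> / l + \<tau> / - ln \<delta>) \<longlongrightarrow> \<tau> / l + 0) (at_right 0)"
  proof (intro tendsto_add tendsto_const tendsto_divide_0[OF tendsto_const])
    show "filterlim (\<lambda>\<delta>. - ln \<delta> :: real) at_infinity (at_right 0)"
      using filterlim_uminus_at_top_at_bot ln_at_0
      by (intro filterlim_at_top_imp_at_infinity) (auto intro: filterlim_compose)
  qed
  then have "Limsup (at_right 0) (\<lambda>\<delta>. ereal (\<tau> / l + \<tau> / - ln \<delta>)) = ereal (\<tau> / l)"
    by (intro lim_imp_Limsup) auto
  then show ?thesis
    using Limsup_mono[OF le] unfolding upper_box_dim_def l_def by simp
qed

lemma limit_set_restrict: "limit_set M r b (restrict x (nodes M)) = limit_set M r b x"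
proof -
  have "path_labels (restrict x (nodes M)) (map u [0..<n]) = path_labels x (map u [0..<n])"
    if "\<forall>n. u n \<in> {1..M}" for u n
    using that by (intro path_labels_cong[of M]) auto
  note same = this
  show ?thesis
    unfolding limit_set_def
  proof (intro Collect_cong ex_cong1 conj_cong refl)
    fix y and u :: "nat \<Rightarrow> nat" assume u: "\<forall>n. u n \<in> {1..M}"
    show "(\<forall>n. y \<in> word_map r b (path_labels (restrict x (nodes M)) (map u [0..<Suc n])) ` {0..1}) =
        (\<forall>n. y \<in> word_map r b (path_labels x (map u [0..<Suc n])) ` {0..1})"
      by (simp only: same[OF u])
  qed
qed

end

section \<open>Two estimates for independent events\<close>

text \<open>
  Chebyshev's inequality under the conditional probability given \<open>E\<close>, with the conditions
  multiplied by \<open>prob E\<close> so that \<open>E\<close> may be a null set. Given \<open>E\<close>, the events \<open>A v\<close> are pairwise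
  independent of probability \<open>p\<close>, so the number of those that occur has mean
  \<open>m = card B * p\<close> and variance at most \<open>m\<close>. It deviates from \<open>m\<close> by \<open>m / 2\<close> with
  probability at most \<open>4 / m\<close>, and \<open>m \<ge> 8\<close> makes this at most one half.
\<close>
lemma (in prob_space) conditional_lower_tail:
  fixes A :: "'i \<Rightarrow> 'a set"
  assumes B: "finite B" and E: "E \<in> events" and A: "\<And>v. v \<in> B \<Longrightarrow> A v \<in> events"
    and one: "\<And>v. v \<in> B \<Longrightarrow> prob (E \<inter> A v) = prob E * p"
    and two: "\<And>u v. u \<in> B \<Longrightarrow> v \<in> B \<Longrightarrow> u \<noteq> v \<Longrightarrow> prob (E \<inter> (A u \<inter> A v)) = prob E * p\<^sup>2"
    and big: "8 \<le> real (card B) * p" and d: "real d \<le> real (card B) * p / 2"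
  shows "prob E / 2 \<le> prob {x \<in> E. d \<le> card {v \<in> B. x \<in> A v}}"
    and "{x \<in> E. d \<le> card {v \<in> B. x \<in> A v}} \<in> events"
proof -
  define m where "m = real (card B) * p"
  define S where "S x = (\<Sum>v\<in>B. indicator (A v) x :: real)" for x
  have S: "S x = real (card {v \<in> B. x \<in> A v})" for x
    unfolding S_def using B by (simp add: indicator_def sum.If_cases Int_def)
  have Em: "E \<inter> (A u \<inter> A v) \<in> events" "E \<inter> A v \<in> events" if "u \<in> B" "v \<in> B" for u v
    using E A that by auto
  have Smeas: "S \<in> borel_measurable M"
    unfolding S_def[abs_def] using A by (intro borel_measurable_sum borel_measurable_indicator) auto
  define F where "F = {x \<in> space M. x \<in> E \<and> S x < real d}"
  have F: "F \<in> events" unfolding F_def using E Smeas by measurable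
  define G where "G = {x \<in> E. d \<le> card {v \<in> B. x \<in> A v}}"
  have GF: "G = E - F" using sets.sets_into_space[OF E] by (auto simp: G_def F_def S)
  then show "{x \<in> E. d \<le> card {v \<in> B. x \<in> A v}} \<in> events" using E F by (simp add: G_def)
  define Z where "Z x = indicator E x * (S x - m)\<^sup>2" for x
  have Z: "Z x = (\<Sum>u\<in>B. \<Sum>v\<in>B. indicator (E \<inter> (A u \<inter> A v)) x)
      - 2 * m * (\<Sum>v\<in>B. indicator (E \<inter> A v) x) + m\<^sup>2 * indicator E x" for x
  proof -
    have "(\<Sum>u\<in>B. \<Sum>v\<in>B. indicator (E \<inter> (A u \<inter> A v)) x) = indicator E x * (S x)\<^sup>2"
      unfolding S_def power2_eq_square sum_product
      by (simp add: sum_distrib_left indicator_inter_arith)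
    moreover have "(\<Sum>v\<in>B. indicator (E \<inter> A v) x) = indicator E x * S x"
      by (simp add: S_def sum_distrib_left indicator_inter_arith)
    ultimately show ?thesis by (simp add: Z_def power2_eq_square algebra_simps)
  qed
  have int: "integrable M (indicator C :: 'a \<Rightarrow> real)" if "C \<in> events" for C
    using that by (intro integrable_real_indicator) (auto simp: emeasure_eq_measure)
  have intZ: "integrable M Z"
    unfolding Z[abs_def]
    by (intro Bochner_Integration.integrable_add Bochner_Integration.integrable_diff
        Bochner_Integration.integrable_sum integrable_mult_right int Em E)
  \<comment> \<open>The off-diagonal sum is enlarged to all pairs, so that no term for \<open>card B - 1\<close> appears.\<close>
  have "(\<Sum>u\<in>B. \<Sum>v\<in>B. prob (E \<inter> (A u \<inter> A v))) \<le> (\<Sum>u\<in>B. prob E * p + (\<Sum>v\<in>B. prob E * p\<^sup>2))"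
  proof (rule sum_mono)
    fix u assume u: "u \<in> B"
    have "(\<Sum>v\<in>B. prob (E \<inter> (A u \<inter> A v))) = prob (E \<inter> (A u \<inter> A u)) + (\<Sum>v\<in>B-{u}. prob (E \<inter> (A u \<inter> A v)))"
      using B u by (rule sum.remove)
    also have "\<dots> = prob E * p + (\<Sum>v\<in>B-{u}. prob E * p\<^sup>2)"
      using one[OF u] two[OF u] by (intro arg_cong2[where f = "(+)"] sum.cong) auto
    also have "\<dots> \<le> prob E * p + (\<Sum>v\<in>B. prob E * p\<^sup>2)"
      using B by (intro add_left_mono sum_mono2) auto
    finally show "(\<Sum>v\<in>B. prob (E \<inter> (A u \<inter> A v))) \<le> \<dots>" .
  qed
  also have "\<dots> = prob E * m + prob E * m\<^sup>2"
    by (simp add: m_def power2_eq_square algebra_simps)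
  finally have pairs: "(\<Sum>u\<in>B. \<Sum>v\<in>B. prob (E \<inter> (A u \<inter> A v))) \<le> prob E * m + prob E * m\<^sup>2" .
  have singles: "(\<Sum>v\<in>B. prob (E \<inter> A v)) = prob E * m"
    using one by (simp add: m_def)
  have "(\<integral>x. Z x \<partial>M) = (\<Sum>u\<in>B. \<Sum>v\<in>B. prob (E \<inter> (A u \<inter> A v)))
      - 2 * m * (\<Sum>v\<in>B. prob (E \<inter> A v)) + m\<^sup>2 * prob E"
  proof -
    have sp: "E \<inter> (A u \<inter> A v) \<inter> space M = E \<inter> (A u \<inter> A v)" "E \<inter> A v \<inter> space M = E \<inter> A v"
      "E \<inter> space M = E" for u v
      using sets.sets_into_space[OF E] by auto
    have i1: "integrable M (\<lambda>x. \<Sum>u\<in>B. \<Sum>v\<in>B. indicator (E \<inter> (A u \<inter> A v)) x :: real)"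
      and i2: "integrable M (\<lambda>x. \<Sum>v\<in>B. indicator (E \<inter> A v) x :: real)"
      by (intro Bochner_Integration.integrable_sum int Em; assumption)+
    have "(\<integral>x. Z x \<partial>M) = (\<integral>x. (\<Sum>u\<in>B. \<Sum>v\<in>B. indicator (E \<inter> (A u \<inter> A v)) x) \<partial>M)
      - 2 * m * (\<integral>x. (\<Sum>v\<in>B. indicator (E \<inter> A v) x) \<partial>M) + m\<^sup>2 * (\<integral>x. indicator E x \<partial>M)"
      unfolding Z[abs_def] using i1 i2 int[OF E] by simp
    moreover have "(\<integral>x. (\<Sum>u\<in>B. \<Sum>v\<in>B. indicator (E \<inter> (A u \<inter> A v)) x) \<partial>M)
        = (\<Sum>u\<in>B. \<Sum>v\<in>B. prob (E \<inter> (A u \<inter> A v)))"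
      by (subst Bochner_Integration.integral_sum, intro Bochner_Integration.integrable_sum int Em, assumption+)
        (intro sum.cong refl, subst Bochner_Integration.integral_sum, intro int Em, assumption+, simp add: sp)
    moreover have "(\<integral>x. (\<Sum>v\<in>B. indicator (E \<inter> A v) x) \<partial>M) = (\<Sum>v\<in>B. prob (E \<inter> A v))"
      by (subst Bochner_Integration.integral_sum, intro int Em, assumption+) (simp add: sp)
    ultimately show ?thesis by (simp add: sp)
  qed
  then have Zle: "(\<integral>x. Z x \<partial>M) \<le> prob E * m"
    using pairs unfolding singles by (simp add: power2_eq_square algebra_simps)
  have "m\<^sup>2 / 4 * prob F = (\<integral>x. m\<^sup>2 / 4 * indicator F x \<partial>M)"
    using F sets.sets_into_space[OF F] by (simp add: Int_absorb2)
  also have "\<dots> \<le> (\<integral>x. Z x \<partial>M)"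
  proof (rule integral_mono)
    show "integrable M (\<lambda>x. m\<^sup>2 / 4 * indicator F x)" using int[OF F] by simp
    show "integrable M Z" by (rule intZ)
    fix x
    show "m\<^sup>2 / 4 * indicator F x \<le> Z x"
    proof (cases "x \<in> F")
      case True
      then have "m / 2 \<le> m - S x" "x \<in> E" using d unfolding m_def[symmetric] by (auto simp: F_def)
      then have "(m / 2)\<^sup>2 \<le> (m - S x)\<^sup>2" using big by (intro power_mono) (auto simp: m_def)
      then show ?thesis using True \<open>x \<in> E\<close> by (simp add: Z_def power_divide power2_commute)
    qed (simp add: Z_def)
  qed
  finally have "m\<^sup>2 / 4 * prob F \<le> prob E * m" using Zle by simp
  then have "m * (m / 4 * prob F) \<le> m * prob E" by (simp add: power2_eq_square algebra_simps)
  then have "m / 4 * prob F \<le> prob E" using big unfolding m_def[symmetric] by simp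
  moreover have "2 * prob F \<le> m / 4 * prob F"
    using big unfolding m_def[symmetric] by (intro mult_right_mono) auto
  ultimately have "prob F \<le> prob E / 2" by simp
  moreover have "prob G = prob E - prob F"
    unfolding GF using E F by (intro finite_measure_Diff) (auto simp: F_def)
  ultimately show "prob E / 2 \<le> prob {x \<in> E. d \<le> card {v \<in> B. x \<in> A v}}" by (simp add: G_def)
qed

lemma (in prob_space) AE_ex_indep_bool:
  assumes indep: "indep_vars (\<lambda>_. count_space UNIV) Y (UNIV :: nat set)"
    and eps: "0 < \<epsilon>" "\<And>n. \<epsilon> \<le> \<P>(x in M. Y n x)"
  shows "AE x in M. \<exists>n. Y n x"
proof -
  have [measurable]: "Measurable.pred M (Y n)" for n
    using indep by (auto simp: indep_vars_def)
  define b where "b = \<P>(x in M. \<forall>n. \<not> Y n x)"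
  have "b \<le> (1 - \<epsilon>) ^ m" if "0 < m" for m
  proof -
    have "(\<Inter>n\<in>{..<m}. Y n -` {False} \<inter> space M) = {x \<in> space M. \<forall>n\<in>{..<m}. \<not> Y n x}"
      using that by auto
    moreover have "{x \<in> space M. \<forall>n\<in>{..<m}. \<not> Y n x} \<in> events" by measurable
    ultimately have "b \<le> prob (\<Inter>n\<in>{..<m}. Y n -` {False} \<inter> space M)"
      unfolding b_def by (intro finite_measure_mono) auto
    also have "\<dots> = (\<Prod>n\<in>{..<m}. prob (Y n -` {False} \<inter> space M))"
      using that by (intro indep_varsD[OF indep]) auto
    also have "\<dots> \<le> (\<Prod>n\<in>{..<m}. 1 - \<epsilon>)"
    proof (rule prod_mono, safe)
      fix n
      have "prob (Y n -` {False} \<inter> space M) = prob (space M - {x \<in> space M. Y n x})"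
        by (rule arg_cong[where f = prob]) auto
      also have "\<dots> = 1 - \<P>(x in M. Y n x)" by (rule prob_compl) simp
      finally show "prob (Y n -` {False} \<inter> space M) \<le> 1 - \<epsilon>" using eps(2)[of n] by simp
    qed simp
    finally show ?thesis by simp
  qed
  moreover have "\<epsilon> \<le> 1" using eps(2)[of 0] prob_le_1 by (rule order_trans)
  then have "(\<lambda>m. (1 - \<epsilon>) ^ m) \<longlonglongrightarrow> 0" using eps(1) by (intro LIMSEQ_realpow_zero) auto
  ultimately have "b \<le> 0"
    by (intro tendsto_lowerbound[of "\<lambda>m. (1 - \<epsilon>) ^ m" 0 sequentially b])
      (auto simp: eventually_sequentially intro!: exI[of _ 1])
  then have "b = 0" unfolding b_def by (simp add: measure_le_0_iff)
  then show ?thesis unfolding b_def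
    by (subst (asm) prob_eq_0) auto
qed

section \<open>Random labels\<close>

locale label_tree =
  fixes M :: nat and Q :: "nat measure"
  assumes M2: "2 \<le> M" and Q: "prob_space Q" and discrete: "sets Q = Pow (space Q)"
begin

text \<open>
  The root is not in the index set, as its label has no meaning. Points of this space are therefore
  functions that are undefined outside \<open>nodes M\<close>, and a subtree of such a tree must be restricted
  before it is again a point of the space.
\<close>
definition tree_space :: "(nat list \<Rightarrow> nat) measure" where
  "tree_space = PiM (nodes M) (\<lambda>_. Q)"

sublocale prob_space tree_space
  unfolding tree_space_def using Q by (intro prob_space_PiM)

text \<open>
  Properties that make sense for subtrees as well: measurable, and independent of the values
  outside \<open>nodes M\<close>.
\<close>
definition tree_pred :: "((nat list \<Rightarrow> nat) \<Rightarrow> bool) \<Rightarrow> bool" where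
  "tree_pred P \<longleftrightarrow> Measurable.pred tree_space P \<and> (\<forall>x. P (restrict x (nodes M)) = P x)"

lemma append_in_nodes: "set w \<subseteq> {1..M} \<Longrightarrow> u \<in> nodes M \<Longrightarrow> w @ u \<in> nodes M"
  by (auto simp: nodes_def)

lemma restrict_subtree_measurable:
  assumes "\<And>u. u \<in> nodes M \<Longrightarrow> w @ u \<in> K"
  shows "(\<lambda>x. restrict (subtree x w) (nodes M)) \<in> measurable (PiM K (\<lambda>_. Q)) tree_space"
  unfolding tree_space_def subtree_def
  using assms by (intro measurable_restrict measurable_component_singleton)

lemma tree_pred_subtree_measurable:
  assumes P: "tree_pred P" and K: "\<And>u. u \<in> nodes M \<Longrightarrow> w @ u \<in> K"
  shows "Measurable.pred (PiM K (\<lambda>_. Q)) (\<lambda>x. P (subtree x w))"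
proof -
  have "Measurable.pred (PiM K (\<lambda>_. Q)) (\<lambda>x. P (restrict (subtree x w) (nodes M)))"
    using P unfolding tree_pred_def by (intro measurable_compose[OF restrict_subtree_measurable[OF K]]) auto
  then show ?thesis using P by (simp add: tree_pred_def)
qed

lemma tree_pred_subtree:
  assumes P: "tree_pred P" and w: "set w \<subseteq> {1..M}"
  shows "tree_pred (\<lambda>x. P (subtree x w))"
  unfolding tree_pred_def
proof
  show "Measurable.pred tree_space (\<lambda>x. P (subtree x w))"
    unfolding tree_space_def using append_in_nodes[OF w]
    by (intro tree_pred_subtree_measurable[OF P]) auto
  have "restrict (subtree (restrict x (nodes M)) w) (nodes M) = restrict (subtree x w) (nodes M)" for x :: "nat list \<Rightarrow> nat"
    using append_in_nodes[OF w] by (auto simp: subtree_def restrict_def fun_eq_iff)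
  then show "\<forall>x. P (subtree (restrict x (nodes M)) w) = P (subtree x w)"
    using P unfolding tree_pred_def by metis
qed

text \<open>
  The labels below \<open>w\<close> are a reindexed subfamily of the independent identically distributed labels
  of the tree.
\<close>
lemma prob_subtree:
  assumes P: "tree_pred P" and w: "set w \<subseteq> {1..M}"
  shows "\<P>(x in tree_space. P (subtree x w)) = \<P>(x in tree_space. P x)"
proof -
  let ?s = "\<lambda>x. restrict (subtree x w) (nodes M)"
  have s: "?s \<in> measurable tree_space tree_space"
    using restrict_subtree_measurable[of w "nodes M"] append_in_nodes[OF w]
    by (simp add: tree_space_def)
  have "distr (PiM (nodes M) (\<lambda>_. Q)) (PiM (nodes M) (\<lambda>_. Q)) (\<lambda>x. \<lambda>u\<in>nodes M. x (w @ u)) = PiM (nodes M) (\<lambda>_. Q)"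
    using append_in_nodes[OF w] Q by (intro distr_PiM_reindex) (auto simp: inj_on_def)
  then have d: "distr tree_space tree_space ?s = tree_space"
    by (simp add: tree_space_def subtree_def)
  have meas: "{x \<in> space tree_space. P x} \<in> sets tree_space"
    using P unfolding tree_pred_def pred_def by blast
  have "\<P>(x in tree_space. P x) = measure (distr tree_space tree_space ?s) {x \<in> space tree_space. P x}"
    by (simp add: d)
  also have "\<dots> = measure tree_space (?s -` {x \<in> space tree_space. P x} \<inter> space tree_space)"
    by (rule measure_distr[OF s meas])
  also have "?s -` {x \<in> space tree_space. P x} \<inter> space tree_space = {x \<in> space tree_space. P (subtree x w)}"
    using measurable_space[OF s] P by (auto simp: tree_pred_def)
  finally show ?thesis ..
qed

lemma indep_coordinates:
  "indep_vars (\<lambda>_. Q) (\<lambda>u x. x u) (nodes M)"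
proof -
  interpret pp: product_prob_space "\<lambda>_. Q" "nodes M"
    using Q by (intro product_prob_spaceI)
  have ne: "nodes M \<noteq> {}" using M2 by (auto simp: nodes_def intro!: exI[of _ "[1]"])
  have "distr (PiM (nodes M) (\<lambda>_. Q)) (PiM (nodes M) (\<lambda>_. Q)) (\<lambda>x. \<lambda>u\<in>nodes M. x u) = PiM (nodes M) (\<lambda>_. Q)"
    using Q by (intro distr_PiM_reindex) auto
  then show ?thesis
    unfolding tree_space_def[symmetric]
    by (subst indep_vars_iff_distr_eq_PiM'[OF ne])
      (auto simp: tree_space_def pp.PiM_component intro!: measurable_component_singleton PiM_cong)
qed

text \<open>
  The coordinates of the product space are independent, and independence passes to functions of
  disjoint groups of coordinates.
\<close>
lemma indep_local_preds:
  assumes K: "\<And>j. j \<in> L \<Longrightarrow> K j \<subseteq> nodes M" "disjoint_family_on K L"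
    and R: "\<And>j. j \<in> L \<Longrightarrow> Measurable.pred (PiM (K j) (\<lambda>_. Q)) (R j)"
    and loc: "\<And>j x. j \<in> L \<Longrightarrow> R j (restrict x (K j)) = R j x"
  shows "indep_vars (\<lambda>_. count_space UNIV) R L"
proof -
  have "indep_vars (\<lambda>j. PiM (K j) (\<lambda>_. Q)) (\<lambda>j x. restrict (\<lambda>u. x u) (K j)) L"
    using K by (intro indep_vars_restrict[OF indep_coordinates]) auto
  from indep_vars_compose2[OF this, of R "\<lambda>_. count_space UNIV"]
  have "indep_vars (\<lambda>_. count_space UNIV) (\<lambda>j x. R j (restrict (\<lambda>u. x u) (K j))) L"
    using R by blast
  moreover have "indep_vars (\<lambda>_. count_space UNIV) (\<lambda>j x. R j (restrict (\<lambda>u. x u) (K j))) L \<longleftrightarrow>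
      indep_vars (\<lambda>_. count_space UNIV) R L"
    using loc by (intro indep_vars_cong refl) simp
  ultimately show ?thesis by simp
qed

lemma prob_local_preds:
  assumes "indep_vars (\<lambda>_. count_space UNIV) R L" "finite J" "J \<noteq> {}" "J \<subseteq> L"
  shows "\<P>(x in tree_space. \<forall>j\<in>J. R j x) = (\<Prod>j\<in>J. \<P>(x in tree_space. R j x))"
proof -
  have e: "R j -` {True} \<inter> space tree_space = {x \<in> space tree_space. R j x}" for j by auto
  have "(\<Inter>j\<in>J. R j -` {True} \<inter> space tree_space) = {x \<in> space tree_space. \<forall>j\<in>J. R j x}"
    using assms(3) by auto
  then show ?thesis
    using indep_varsD[OF assms(1), of J "\<lambda>_. {True}"] assms(2,3,4) unfolding e by simp
qed

lemma label_measurable: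
  assumes "u \<in> K" shows "(\<lambda>x. x u) \<in> measurable (PiM K (\<lambda>_. Q)) (count_space UNIV)"
proof -
  have "(\<lambda>x. x) \<in> measurable Q (count_space UNIV)"
    using discrete by (auto simp: measurable_def)
  then show ?thesis
    using measurable_compose[OF measurable_component_singleton[OF assms, of "\<lambda>_. Q"]] by blast
qed

text \<open>
  Only labels at depth at most \<open>k\<close> are inspected, so the property is measurable on every product
  whose index set contains these nodes. Equality of two labels is spelled out by their common value,
  which turns it into a countable union of elementary events.
\<close>
lemma pred_inj_on_path_labels:
  assumes B: "B \<subseteq> words M k" and K: "\<And>u. u \<in> nodes M \<Longrightarrow> length u \<le> k \<Longrightarrow> u \<in> K"
  shows "Measurable.pred (PiM K (\<lambda>_. Q)) (\<lambda>x. inj_on (path_labels x) B)"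
proof -
  have eq: "inj_on (path_labels x) B \<longleftrightarrow>
      (\<forall>u\<in>B. \<forall>v\<in>B. (\<forall>i\<in>{1..k}. \<exists>a. x (take i u) = a \<and> x (take i v) = a) \<longrightarrow> u = v)"
    for x :: "nat list \<Rightarrow> nat"
  proof -
    have *: "path_labels x u = path_labels x v \<longleftrightarrow>
        (\<forall>i\<in>{1..k}. \<exists>a. x (take i u) = a \<and> x (take i v) = a)"
      if "u \<in> B" "v \<in> B" for u v
    proof -
      have "length u = k" "length v = k" using that B by (auto simp: words_def)
      moreover have "set [1..<Suc k] = {1..k}" by auto
      ultimately show ?thesis unfolding path_labels_conv_map map_eq_conv by (auto simp del: upt_Suc)
    qed
    show ?thesis unfolding inj_on_def by (intro ball_cong refl) (simp only: *)
  qed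
  have fin: "finite B" using B by (rule finite_subset) simp
  have lab: "Measurable.pred (PiM K (\<lambda>_. Q)) (\<lambda>x. x (take i u) = a)" if "u \<in> B" "i \<in> {1..k}" for u i a
  proof -
    have "take i u \<in> K"
      using that B by (intro K) (auto simp: words_def nodes_def dest: in_set_takeD)
    from measurable_sets[OF label_measurable[OF this], of "{a}"]
    show ?thesis by (simp add: pred_def vimage_def Int_def conj_commute)
  qed
  show ?thesis
    unfolding eq using fin lab
    by (intro pred_intros_finite pred_intros_logic pred_intros_countable) auto
qed

lemma tree_pred_regular: "tree_pred (regular M k d j)"
proof (induction j)
  case 0
  show ?case by (simp add: tree_pred_def)
next
  case (Suc j)
  have "Measurable.pred tree_space (regular M k d (Suc j))"
  proof -
    have "Measurable.pred tree_space (\<lambda>x. \<exists>B\<in>Pow (words M k). card B = d \<and> inj_on (path_labels x) B \<and>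
        (\<forall>v\<in>B. regular M k d j (subtree x v)))"
    proof (intro pred_intros_finite pred_intros_logic)
      fix B assume B: "B \<in> Pow (words M k)"
      then show "finite B" by (auto intro: finite_subset)
      show "Measurable.pred tree_space (\<lambda>x. inj_on (path_labels x) B)"
        unfolding tree_space_def using B by (intro pred_inj_on_path_labels) auto
      fix v assume v: "v \<in> B"
      then show "Measurable.pred tree_space (\<lambda>x. regular M k d j (subtree x v))"
        using tree_pred_subtree[OF Suc.IH, of v] B unfolding tree_pred_def by (auto simp: words_def)
    qed auto
    then show ?thesis
      unfolding regular.simps by (simp only: Bex_def Pow_iff)
  qed
  moreover have "regular M k d (Suc j) (restrict x (nodes M)) = regular M k d (Suc j) x" for x :: "nat list \<Rightarrow> nat"
  proof -
    have "inj_on (path_labels (restrict x (nodes M))) B = inj_on (path_labels x) B" if "B \<subseteq> words M k" for B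
      using that by (intro inj_on_cong path_labels_cong[of M]) (auto simp: words_def)
    moreover have "regular M k d j (subtree (restrict x (nodes M)) v) = regular M k d j (subtree x v)"
      if "v \<in> words M k" for v
      using tree_pred_subtree[OF Suc.IH, of v] that unfolding tree_pred_def by (auto simp: words_def)
    ultimately show ?thesis unfolding regular.simps by (intro ex_cong1 conj_cong ball_cong refl) auto
  qed
  ultimately show ?case by (simp add: tree_pred_def del: regular.simps)
qed

section \<open>Regular subtrees and level counts of the random tree\<close>

lemma distinct_families_local:
  assumes K: "\<And>u. u \<in> nodes M \<Longrightarrow> length u \<le> k \<Longrightarrow> u \<in> K"
  shows "distinct_families M k (restrict x K) = distinct_families M k x"
proof -
  have "inj_on (path_labels (restrict x K)) B = inj_on (path_labels x) B" if "B \<in> Pow (words M k)" for B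
    using that K by (intro inj_on_cong path_labels_cong[of M]) (auto simp: words_def)
  then show ?thesis unfolding distinct_families_def by blast
qed

lemma pred_distinct_families:
  assumes K: "\<And>u. u \<in> nodes M \<Longrightarrow> length u \<le> k \<Longrightarrow> u \<in> K" and S: "S \<subseteq> Pow (words M k)"
  shows "Measurable.pred (PiM K (\<lambda>_. Q)) (\<lambda>x. distinct_families M k x = S)"
proof -
  have eq: "distinct_families M k x = S \<longleftrightarrow> (\<forall>B\<in>Pow (words M k). inj_on (path_labels x) B = (B \<in> S))"
    for x :: "nat list \<Rightarrow> nat"
    using S unfolding distinct_families_def by blast
  show ?thesis
    unfolding eq
  proof (rule pred_intros_finite)
    fix B assume "B \<in> Pow (words M k)"
    then have "Measurable.pred (PiM K (\<lambda>_. Q)) (\<lambda>x. inj_on (path_labels x) B)"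
      using K by (intro pred_inj_on_path_labels) auto
    then show "Measurable.pred (PiM K (\<lambda>_. Q)) (\<lambda>x. inj_on (path_labels x) B = (B \<in> S))"
      by (cases "B \<in> S") auto
  qed simp
qed

lemma tree_pred_distinct_families:
  "S \<subseteq> Pow (words M k) \<Longrightarrow> tree_pred (\<lambda>x. distinct_families M k x = S)"
  using pred_distinct_families[of k "nodes M" S]
  unfolding tree_pred_def tree_space_def by (simp add: distinct_families_local)

definition tail_prob :: "nat \<Rightarrow> nat \<Rightarrow> real" where
  "tail_prob k h = \<P>(x in tree_space. h \<le> level_count M k x)"

text \<open>
  The mean of \<open>level_count\<close>, as the sum of its tail probabilities. In this form the inequalities
  of \<open>markov_tail\<close> and \<open>heavy_tail\<close> are comparisons of finite sums.
\<close>
definition mean_count :: "nat \<Rightarrow> real" where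
  "mean_count k = (\<Sum>h=1..M ^ k. tail_prob k h)"

lemma level_count_pred: "Measurable.pred tree_space (\<lambda>x. h \<le> level_count M k x)"
proof -
  have eq: "h \<le> level_count M k x \<longleftrightarrow> (\<exists>B\<in>Pow (words M k). card B = h \<and> inj_on (path_labels x) B)"
    for x :: "nat list \<Rightarrow> nat"
    unfolding level_count_ge_iff distinct_families_def by auto
  show ?thesis
    unfolding eq tree_space_def
    by (intro pred_intros_finite pred_intros_logic pred_inj_on_path_labels) auto
qed

lemma level_count_event: "{x \<in> space tree_space. h \<le> level_count M k x} \<in> events"
  using level_count_pred by (simp add: pred_def)

lemma tail_antimono: "h \<le> h' \<Longrightarrow> tail_prob k h' \<le> tail_prob k h"
  unfolding tail_prob_def using level_count_event by (intro finite_measure_mono) auto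

lemma tail_1: "tail_prob k 1 = 1"
  using M2 prob_space by (simp add: tail_prob_def level_count_bounds(1)[simplified])

lemma tail_eq_0:
  assumes "M ^ k < h" shows "tail_prob k h = 0"
proof -
  have "\<not> h \<le> level_count M k x" for x :: "nat list \<Rightarrow> nat"
    using level_count_bounds(2)[of M k x] assms by simp
  then show ?thesis by (simp add: tail_prob_def)
qed

lemma markov_tail: "real h * tail_prob k h \<le> mean_count k"
proof (cases "h \<le> M ^ k")
  case True
  have "real h * tail_prob k h = (\<Sum>i=1..h. tail_prob k h)" by simp
  also have "\<dots> \<le> (\<Sum>i=1..h. tail_prob k i)" by (intro sum_mono tail_antimono) auto
  also have "\<dots> \<le> mean_count k"
    unfolding mean_count_def using True by (intro sum_mono2) (auto simp: tail_prob_def)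
  finally show ?thesis .
next
  case False
  then have "tail_prob k h = 0" by (intro tail_eq_0) simp
  then show ?thesis by (simp add: mean_count_def sum_nonneg tail_prob_def)
qed

lemma mean_bounds: "1 \<le> mean_count k" "mean_count k \<le> real M ^ k"
proof -
  show "1 \<le> mean_count k" using markov_tail[of 1 k] tail_1[of k] by simp
  have "mean_count k \<le> (\<Sum>h=1..M ^ k. 1)" unfolding mean_count_def by (intro sum_mono) (simp add: tail_prob_def)
  then show "mean_count k \<le> real M ^ k" by simp
qed

text \<open>
  If the claim failed for all \<open>h\<close>, the tail probabilities would be smaller than
  \<open>mean_count k / (L * h)\<close> with \<open>L = 1 + k * ln M\<close>. Their sum, the mean, would then be smaller
  than \<open>mean_count k * harm (M ^ k) / L\<close>, although \<open>harm H \<le> 1 + ln H\<close>.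
\<close>
lemma heavy_tail:
  obtains h where "1 \<le> h" "mean_count k \<le> real h * tail_prob k h * (1 + real k * ln (real M))"
proof -
  define H where "H = M ^ k"
  have H: "1 \<le> H" using M2 by (simp add: H_def)
  define L where "L = 1 + real k * ln (real M)"
  have L: "0 < L" using M2 by (simp add: L_def add_pos_nonneg)
  have "harm H \<le> 1 + ln (real H)"
    using euler_mascheroni_sequence_decreasing[of 1 H] H by (simp add: harm_def)
  also have "\<dots> = L" using M2 by (simp add: H_def L_def ln_realpow)
  finally have harm: "harm H \<le> L" .
  have "\<exists>h\<in>{1..H}. mean_count k \<le> real h * tail_prob k h * L"
  proof (rule ccontr)
    assume "\<not> ?thesis"
    then have less: "tail_prob k h < mean_count k / L * inverse (real h)" if "h \<in> {1..H}" for h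
      using that L by (auto simp: field_simps not_le)
    have "mean_count k = (\<Sum>h=1..H. tail_prob k h)" by (simp add: mean_count_def H_def)
    also have "\<dots> < (\<Sum>h=1..H. mean_count k / L * inverse (real h))"
      using less H by (intro sum_strict_mono) auto
    also have "\<dots> = mean_count k / L * harm H" by (simp add: harm_def sum_distrib_left)
    also have "\<dots> \<le> mean_count k / L * L"
      using harm L mean_bounds(1)[of k] by (intro mult_left_mono) auto
    finally show False using L by simp
  qed
  then show ?thesis using that unfolding L_def by auto
qed

text \<open>
  The first factor depends on the labels at depth at most \<open>k\<close>, the others on the labels strictly
  below different nodes of depth \<open>k\<close>; these sets of nodes are disjoint.
\<close>
lemma prob_block_and_subtrees:
  assumes k: "0 < k" and P: "tree_pred P" and S: "S \<subseteq> Pow (words M k)" and J: "J \<subseteq> words M k"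
  shows "\<P>(x in tree_space. distinct_families M k x = S \<and> (\<forall>v\<in>J. P (subtree x v))) =
    \<P>(x in tree_space. distinct_families M k x = S) * \<P>(x in tree_space. P x) ^ card J"
proof -
  define K where "K v = (if v = [] then {u \<in> nodes M. length u \<le> k} else (\<lambda>u. v @ u) ` nodes M)" for v
  define R where "R v x = (if v = [] then distinct_families M k x = S else P (subtree x v))"
    for v and x :: "nat list \<Rightarrow> nat"
  have w: "v \<noteq> []" "set v \<subseteq> {1..M}" "length v = k" if "v \<in> words M k" for v
    using that k by (auto simp: words_def)
  have fin: "finite J" using J by (rule finite_subset) simp
  have "indep_vars (\<lambda>_. count_space UNIV) R (insert [] J)"
  proof (rule indep_local_preds)
    show "K v \<subseteq> nodes M" if "v \<in> insert [] J" for v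
      using that J append_in_nodes w by (auto simp: K_def)
    show "disjoint_family_on K (insert [] J)"
    proof (unfold disjoint_family_on_def, intro ballI impI)
      fix v v' assume v: "v \<in> insert [] J" "v' \<in> insert [] J" "v \<noteq> v'"
      have "length v = k \<or> v = []" "length v' = k \<or> v' = []" using v w J by auto
      then show "K v \<inter> K v' = {}"
        using v(3) by (auto simp: K_def nodes_def)
    qed
    fix v assume v: "v \<in> insert [] J"
    show "Measurable.pred (PiM (K v) (\<lambda>_. Q)) (R v)"
    proof (cases "v = []")
      case True
      then show ?thesis
        unfolding R_def using S by (auto simp: K_def intro: pred_distinct_families)
    next
      case False
      then show ?thesis
        unfolding R_def using tree_pred_subtree_measurable[OF P, of v "K v"] by (simp add: K_def)
    qed
    fix x :: "nat list \<Rightarrow> nat"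
    show "R v (restrict x (K v)) = R v x"
    proof (cases "v = []")
      case True
      then show ?thesis
        unfolding R_def using distinct_families_local[of k "K v" x] by (simp add: K_def)
    next
      case False
      have "restrict (subtree (restrict x (K v)) v) (nodes M) = restrict (subtree x v) (nodes M)"
        using False by (auto simp: K_def subtree_def restrict_def fun_eq_iff)
      then show ?thesis using P False unfolding tree_pred_def R_def by metis
    qed
  qed
  from prob_local_preds[OF this, of "insert [] J"]
  have "\<P>(x in tree_space. \<forall>v\<in>insert [] J. R v x) = (\<Prod>v\<in>insert [] J. \<P>(x in tree_space. R v x))"
    using fin by simp
  also have "\<dots> = \<P>(x in tree_space. R [] x) * (\<Prod>v\<in>J. \<P>(x in tree_space. R v x))"
    using fin J w by (subst prod.insert) auto
  also have "(\<Prod>v\<in>J. \<P>(x in tree_space. R v x)) = (\<Prod>v\<in>J. \<P>(x in tree_space. P x))"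
    using J w prob_subtree[OF P] by (intro prod.cong) (auto simp: R_def)
  finally have *: "\<P>(x in tree_space. \<forall>v\<in>insert [] J. R v x) =
    \<P>(x in tree_space. R [] x) * \<P>(x in tree_space. P x) ^ card J" by simp
  have "(\<forall>v\<in>insert [] J. R v x) \<longleftrightarrow> distinct_families M k x = S \<and> (\<forall>v\<in>J. P (subtree x v))" for x
  proof -
    have "v \<noteq> []" if "v \<in> J" for v using that J w by blast
    then show ?thesis by (auto simp: R_def)
  qed
  then show ?thesis using * by (simp add: R_def)
qed

lemma regular_event: "{x \<in> space tree_space. regular M k d j x} \<in> events"
  using tree_pred_regular[of k d j] unfolding tree_pred_def pred_def by blast

text \<open>
  Split the event that \<open>level_count M k\<close> is at least \<open>K\<close> according to the value \<open>S\<close> of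
  \<open>distinct_families\<close>. On each part, fix a member \<open>B S\<close> with \<open>K\<close> elements. The subtrees at these
  nodes are independent of the part and of each other, and \<open>conditional_lower_tail\<close> shows that with
  conditional probability at least one half, \<open>d\<close> of them are regular to depth \<open>j\<close>.
\<close>
lemma prob_regular_Suc:
  assumes k: "0 < k" and p: "p = \<P>(x in tree_space. regular M k d j x)"
    and big: "8 \<le> real K * p" and d: "real d \<le> real K * p / 2"
  shows "tail_prob k K / 2 \<le> \<P>(x in tree_space. regular M k d (Suc j) x)"
proof -
  \<comment> \<open>The possible values of \<open>distinct_families\<close> on the event that the level count is at least \<open>K\<close>.\<close>
  define SS where "SS = {S \<in> Pow (Pow (words M k)). \<exists>B\<in>S. card B = K}"
  have finSS: "finite SS" unfolding SS_def by simp
  have "\<forall>S\<in>SS. \<exists>B. B \<in> S \<and> card B = K" unfolding SS_def by blast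
  then obtain B where B: "\<And>S. S \<in> SS \<Longrightarrow> B S \<in> S" "\<And>S. S \<in> SS \<Longrightarrow> card (B S) = K"
    by metis
  have Bw: "B S \<subseteq> words M k" if "S \<in> SS" for S
    using B(1)[OF that] that unfolding SS_def by blast
  define E where "E S = {x \<in> space tree_space. distinct_families M k x = S}" for S
  define A where "A v = {x \<in> space tree_space. regular M k d j (subtree x v)}" for v
  define G where "G S = {x \<in> E S. d \<le> card {v \<in> B S. x \<in> A v}}" for S
  have E: "E S \<in> events" if "S \<in> SS" for S
    using tree_pred_distinct_families[of S k] that unfolding E_def SS_def tree_pred_def pred_def by blast
  have A: "A v \<in> events" if "v \<in> words M k" for v
    using tree_pred_subtree[OF tree_pred_regular[of k d j], of v] that
    unfolding A_def tree_pred_def pred_def words_def by blast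
  have block: "prob (E S \<inter> {x \<in> space tree_space. \<forall>v\<in>J. x \<in> A v}) = prob (E S) * p ^ card J"
    if "S \<in> SS" "J \<subseteq> words M k" for S J
  proof -
    have "E S \<inter> {x \<in> space tree_space. \<forall>v\<in>J. x \<in> A v} =
        {x \<in> space tree_space. distinct_families M k x = S \<and> (\<forall>v\<in>J. regular M k d j (subtree x v))}"
      by (auto simp: E_def A_def)
    then show ?thesis
      using prob_block_and_subtrees[OF k tree_pred_regular[of k d j], of S J] that
      by (simp add: E_def p SS_def)
  qed
  have G: "prob (E S) / 2 \<le> prob (G S)" "G S \<in> events" if S: "S \<in> SS" for S
  proof -
    have one: "prob (E S \<inter> A v) = prob (E S) * p" if "v \<in> B S" for v
    proof -
      have "E S \<inter> {x \<in> space tree_space. \<forall>v\<in>{v}. x \<in> A v} = E S \<inter> A v"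
        by (auto simp: A_def)
      then show ?thesis using block[OF S, of "{v}"] that Bw[OF S] by auto
    qed
    have two: "prob (E S \<inter> (A u \<inter> A v)) = prob (E S) * p\<^sup>2" if "u \<in> B S" "v \<in> B S" "u \<noteq> v" for u v
    proof -
      have "E S \<inter> {x \<in> space tree_space. \<forall>v\<in>{u, v}. x \<in> A v} = E S \<inter> (A u \<inter> A v)"
        by (auto simp: A_def)
      then show ?thesis using block[OF S, of "{u, v}"] that Bw[OF S] by (auto simp: power2_eq_square)
    qed
    have fin: "finite (B S)" using Bw[OF S] by (rule finite_subset) simp
    have Aev: "A v \<in> events" if "v \<in> B S" for v using A that Bw[OF S] by blast
    have big': "8 \<le> real (card (B S)) * p" and d': "real d \<le> real (card (B S)) * p / 2"
      using big d B(2)[OF S] by simp_all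
    show "prob (E S) / 2 \<le> prob (G S)" "G S \<in> events"
      unfolding G_def
      by (rule conditional_lower_tail[OF fin E[OF S] Aev one two big' d']; assumption)+
  qed
  have Gsub: "G S \<subseteq> {x \<in> space tree_space. regular M k d (Suc j) x}" if S: "S \<in> SS" for S
  proof
    fix x assume x: "x \<in> G S"
    then have "d \<le> card {v \<in> B S. x \<in> A v}" by (simp add: G_def)
    then obtain C where C: "C \<subseteq> {v \<in> B S. x \<in> A v}" "card C = d"
      by (rule obtain_subset_with_card_n)
    have "B S \<in> distinct_families M k x" using x B(1)[OF S] by (simp add: G_def E_def)
    then have "inj_on (path_labels x) (B S)" by (simp add: distinct_families_def)
    then have "inj_on (path_labels x) C" by (rule inj_on_subset) (use C(1) in blast)
    moreover have "C \<subseteq> words M k" using C(1) Bw[OF S] by blast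
    moreover have "\<forall>v\<in>C. regular M k d j (subtree x v)" using C(1) by (auto simp: A_def)
    ultimately have "regular M k d (Suc j) x" using C(2) by auto
    then show "x \<in> {x \<in> space tree_space. regular M k d (Suc j) x}"
      using x by (simp add: G_def E_def)
  qed
  have "{x \<in> space tree_space. K \<le> level_count M k x} = (\<Union>S\<in>SS. E S)"
  proof -
    have "distinct_families M k x \<in> Pow (Pow (words M k))" for x :: "nat list \<Rightarrow> nat"
      by (auto simp: distinct_families_def)
    then show ?thesis unfolding level_count_ge_iff E_def SS_def by blast
  qed
  then have "tail_prob k K = prob (\<Union>S\<in>SS. E S)" by (simp add: tail_prob_def)
  also have "\<dots> \<le> (\<Sum>S\<in>SS. prob (E S))"
    using finSS E by (intro finite_measure_subadditive_finite) auto
  finally have "tail_prob k K / 2 \<le> (\<Sum>S\<in>SS. prob (E S) / 2)" by (simp flip: sum_divide_distrib)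
  also have "\<dots> \<le> (\<Sum>S\<in>SS. prob (G S))" using G(1) by (intro sum_mono) auto
  also have "\<dots> = prob (\<Union>S\<in>SS. G S)"
    using finSS G(2) by (intro finite_measure_finite_Union[symmetric])
      (auto simp: disjoint_family_on_def G_def E_def)
  also have "\<dots> \<le> \<P>(x in tree_space. regular M k d (Suc j) x)"
    using Gsub regular_event by (intro finite_measure_mono) blast+
  finally show ?thesis .
qed

text \<open>
  The lower bound \<open>p \<ge> tail_prob k K / 2\<close> reproduces itself: it gives
  \<open>K * p \<ge> K * tail_prob k K / 2\<close>, which is at least 8 and at least \<open>2 * d\<close>, as required by
  \<open>prob_regular_Suc\<close>.
\<close>
lemma prob_regular:
  assumes k: "0 < k" and big: "16 \<le> real K * tail_prob k K" and d: "real d \<le> real K * tail_prob k K / 4"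
  shows "tail_prob k K / 2 \<le> \<P>(x in tree_space. regular M k d j x)"
proof (induction j)
  case 0
  have "tail_prob k K \<le> 1" by (simp add: tail_prob_def)
  then show ?case using prob_space by simp
next
  case (Suc j)
  define p where "p = \<P>(x in tree_space. regular M k d j x)"
  have "real K * (tail_prob k K / 2) \<le> real K * p"
    using Suc.IH by (intro mult_left_mono) (auto simp: p_def)
  then show ?case
    using big d by (intro prob_regular_Suc[OF k p_def, of K]) auto
qed

text \<open>
  The nodes \<open>1 \<dots> 1 2\<close> have disjoint, hence independent, sets of descendants, and each of their
  subtrees is regular to all depths with the same positive probability.
\<close>
lemma AE_regular_subtree:
  assumes k: "0 < k" and big: "16 \<le> real K * tail_prob k K" and d: "real d \<le> real K * tail_prob k K / 4"
  shows "AE x in tree_space. \<exists>w. set w \<subseteq> {1..M} \<and> (\<forall>j. regular M k d j (subtree x w))"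
proof -
  define P where "P x \<longleftrightarrow> (\<forall>j. regular M k d j x)" for x :: "nat list \<Rightarrow> nat"
  have P: "tree_pred P"
    using tree_pred_regular[of k d] unfolding tree_pred_def P_def[abs_def]
    by (auto intro!: pred_intros_countable)
  \<comment> \<open>None of these nodes is a prefix of another one; the final 2 exists because \<open>M \<ge> 2\<close>.\<close>
  define w where "w n = replicate n 1 @ [2::nat]" for n
  have w: "set (w n) \<subseteq> {1..M}" for n using M2 by (auto simp: w_def)
  define K' where "K' n = (\<lambda>u. w n @ u) ` nodes M" for n
  have wdiff: "w n @ u \<noteq> w n' @ u'" if "n < n'" for n n' u u'
  proof
    assume "w n @ u = w n' @ u'"
    then have "(w n @ u) ! n = (w n' @ u') ! n" by simp
    then show False using that by (simp add: w_def nth_append)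
  qed
  have "indep_vars (\<lambda>_. count_space UNIV) (\<lambda>n x. P (subtree x (w n))) UNIV"
  proof (rule indep_local_preds)
    show "K' n \<subseteq> nodes M" for n using append_in_nodes[OF w] by (auto simp: K'_def)
    show "disjoint_family_on K' UNIV"
      unfolding disjoint_family_on_def
    proof (intro ballI impI)
      fix n n' :: nat assume "n \<noteq> n'"
      then have "w n @ u \<noteq> w n' @ u'" for u u'
        using wdiff[of n n' u u'] wdiff[of n' n u' u] by (cases "n < n'") auto
      then show "K' n \<inter> K' n' = {}" by (auto simp: K'_def)
    qed
    show "Measurable.pred (PiM (K' n) (\<lambda>_. Q)) (\<lambda>x. P (subtree x (w n)))" for n
      by (rule tree_pred_subtree_measurable[OF P]) (simp add: K'_def)
    fix n and x :: "nat list \<Rightarrow> nat"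
    have "restrict (subtree (restrict x (K' n)) (w n)) (nodes M) = restrict (subtree x (w n)) (nodes M)"
      by (auto simp: K'_def subtree_def restrict_def fun_eq_iff)
    then show "P (subtree (restrict x (K' n)) (w n)) = P (subtree x (w n))"
      using P unfolding tree_pred_def by metis
  qed
  moreover have pos: "0 < tail_prob k K / 2"
  proof -
    have "tail_prob k K \<noteq> 0" using big by auto
    then show ?thesis by (simp add: tail_prob_def zero_less_measure_iff)
  qed
  moreover have "tail_prob k K / 2 \<le> \<P>(x in tree_space. P (subtree x (w n)))" for n
  proof -
    define F where "F j = {x \<in> space tree_space. regular M k d j x}" for j
    have "(\<lambda>j. prob (F j)) \<longlonglongrightarrow> prob (\<Inter>j. F j)"
    proof (rule finite_Lim_measure_decseq)
      show "range F \<subseteq> events" using regular_event by (auto simp: F_def)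
      show "decseq F" unfolding F_def by (intro decseq_SucI) (auto dest: regular_Suc simp del: regular.simps)
    qed
    moreover have "tail_prob k K / 2 \<le> prob (F j)" for j
      unfolding F_def by (rule prob_regular[OF k big d])
    ultimately have "tail_prob k K / 2 \<le> prob (\<Inter>j. F j)" by (intro LIMSEQ_le_const) auto
    also have "(\<Inter>j. F j) = {x \<in> space tree_space. P x}" by (auto simp: F_def P_def)
    finally show ?thesis using prob_subtree[OF P w] by simp
  qed
  ultimately have "AE x in tree_space. \<exists>n. P (subtree x (w n))"
    by (rule AE_ex_indep_bool)
  then show ?thesis
    by (rule AE_mp) (use w in \<open>auto simp: P_def intro!: AE_I2\<close>)
qed

text \<open>
  Markov's inequality bounds the probability of the opposite inequality by
  \<open>exp ((\<sigma> - \<tau>) * k)\<close>, which is summable; Borel and Cantelli do the rest.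
\<close>
lemma AE_level_count_le:
  assumes ev: "\<forall>\<^sub>F k in sequentially. mean_count k \<le> exp (\<sigma> * real k)" and \<tau>: "\<sigma> < \<tau>"
  shows "AE x in tree_space. \<forall>\<^sub>F k in sequentially. real (level_count M k x) \<le> exp (\<tau> * real k)"
proof -
  define h where "h k = nat \<lceil>exp (\<tau> * real k)\<rceil>" for k
  define A where "A k = {x \<in> space tree_space. h k \<le> level_count M k x}" for k
  have A: "A k \<in> events" for k unfolding A_def by (rule level_count_event)
  have "\<forall>\<^sub>F k in sequentially. norm (prob (A k)) \<le> exp (\<sigma> - \<tau>) ^ k"
    using ev
  proof eventually_elim
    case (elim k)
    have "exp (\<tau> * real k) * prob (A k) \<le> real (h k) * tail_prob k (h k)"
      unfolding A_def tail_prob_def h_def by (intro mult_right_mono) (auto intro: real_nat_ceiling_ge)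
    also have "\<dots> \<le> exp (\<sigma> * real k)" using markov_tail[of "h k" k] elim by simp
    finally have "prob (A k) \<le> exp (\<sigma> * real k) / exp (\<tau> * real k)"
      by (simp add: pos_le_divide_eq mult.commute)
    also have "\<dots> = exp (\<sigma> - \<tau>) ^ k"
      by (simp add: exp_diff[symmetric] exp_of_nat_mult[symmetric] algebra_simps)
    finally show ?case by simp
  qed
  then have "summable (\<lambda>k. prob (A k))"
    using \<tau> by (intro summable_comparison_test_ev[OF _ summable_geometric]) auto
  then have "AE x in tree_space. \<forall>\<^sub>F k in sequentially. x \<in> space tree_space - A k"
    using A by (intro borel_cantelli_AE1) (auto simp: emeasure_eq_measure)
  then show ?thesis
  proof (rule AE_mp, intro AE_I2 impI)
    fix x assume "x \<in> space tree_space" "\<forall>\<^sub>F k in sequentially. x \<in> space tree_space - A k"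
    then show "\<forall>\<^sub>F k in sequentially. real (level_count M k x) \<le> exp (\<tau> * real k)"
    proof (elim eventually_mono)
      fix k assume "x \<in> space tree_space - A k"
      then have "level_count M k x < h k" by (auto simp: A_def)
      then show "real (level_count M k x) \<le> exp (\<tau> * real k)" unfolding h_def by linarith
    qed
  qed
qed

end

section \<open>The almost sure dimension of the limit set\<close>

text \<open>
  The quadratic term of the exponential series dominates. The factor 8 is the one that
  \<open>AE_hausdorff_dim_ge\<close> has to absorb.
\<close>
lemma linear_le_exp_eventually:
  fixes c \<eta> :: real
  assumes "0 \<le> c" "0 < \<eta>"
  shows "\<forall>\<^sub>F k in sequentially. 1 + real k * c \<le> exp (\<eta> * real k) / 8"
proof -
  obtain k0 where k0: "16 * (1 + c) / \<eta>\<^sup>2 \<le> real k0" using real_arch_simple by blast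
  show ?thesis
    using eventually_ge_at_top[of "max 1 k0"]
  proof eventually_elim
    case (elim k)
    then have k: "1 \<le> real k" "16 * (1 + c) / \<eta>\<^sup>2 \<le> real k" using k0 by linarith+
    have "8 * (1 + real k * c) \<le> 8 * (1 + c) * real k" using k(1) assms by (simp add: algebra_simps)
    also have "\<dots> \<le> (\<eta>\<^sup>2 * real k / 2) * real k"
      using k assms by (intro mult_right_mono) (simp_all add: field_simps)
    also have "\<dots> = (\<eta> * real k)\<^sup>2 / 2" by (simp add: power2_eq_square)
    also have "\<dots> \<le> exp (\<eta> * real k)"
    proof -
      have "0 \<le> \<eta> * real k" using assms by simp
      then show ?thesis using exp_lower_Taylor_quadratic[of "\<eta> * real k"] by linarith
    qed
    finally show ?case by simp
  qed
qed

locale random_fractal = label_tree M Q + ordered_ifs N r b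
  for M Q N r b +
  assumes labels: "space Q = {1..N}"
begin

lemma label_in: "x \<in> space tree_space \<Longrightarrow> u \<in> nodes M \<Longrightarrow> x u \<in> {1..N}"
  using labels by (auto simp: tree_space_def space_PiM PiE_iff)

definition growth :: ereal where
  "growth = limsup (\<lambda>k. ereal (ln (mean_count k) / (real k * ln (1 / r))))"

lemma growth_bounds: "0 \<le> growth" "growth \<le> ereal (ln (real M) / ln (1 / r))"
proof -
  have l: "0 < ln (1 / r)" by (rule ln_inverse_ratio)
  have "ereal 0 \<le> ereal (ln (mean_count k) / (real k * ln (1 / r)))" for k
    using mean_bounds(1)[of k] l by simp
  then show "0 \<le> growth"
    unfolding growth_def zero_ereal_def by (intro le_Limsup always_eventually allI) auto
  have "ereal (ln (mean_count k) / (real k * ln (1 / r))) \<le> ereal (ln (real M) / ln (1 / r))" for k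
  proof (cases "k = 0")
    case False
    have "ln (mean_count k) \<le> ln (real M ^ k)"
      using mean_bounds[of k] M2 by (subst ln_le_cancel_iff) auto
    also have "\<dots> = real k * ln (real M)" using M2 by (simp add: ln_realpow)
    finally show ?thesis using l False by (simp add: field_simps)
  qed (use l M2 in auto)
  then show "growth \<le> ereal (ln (real M) / ln (1 / r))"
    unfolding growth_def by (intro Limsup_bounded always_eventually allI)
qed

lemma AE_upper_box_dim_le:
  assumes a: "growth < ereal s"
  shows "AE x in tree_space. upper_box_dim (limit_set M r b x) \<le> ereal s"
proof -
  have l: "0 < ln (1 / r)" by (rule ln_inverse_ratio)
  obtain t where t: "growth < ereal t" "t < s"
    using ereal_dense2[OF a] by auto
  have "\<forall>\<^sub>F k in sequentially. ereal (ln (mean_count k) / (real k * ln (1 / r))) < ereal t"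
    using t(1) unfolding growth_def by (rule Limsup_lessD)
  then have "\<forall>\<^sub>F k in sequentially. mean_count k \<le> exp ((t * ln (1 / r)) * real k)"
    using eventually_gt_at_top[of 0]
  proof eventually_elim
    case (elim k)
    then have "ln (mean_count k) \<le> t * ln (1 / r) * real k" using l by (simp add: field_simps)
    then have "exp (ln (mean_count k)) \<le> exp ((t * ln (1 / r)) * real k)" by simp
    then show ?case using mean_bounds(1)[of k] by simp
  qed
  moreover have "t * ln (1 / r) < s * ln (1 / r)" using t(2) l by (simp add: mult_strict_right_mono)
  ultimately have "AE x in tree_space. \<forall>\<^sub>F k in sequentially. real (level_count M k x) \<le> exp (s * ln (1 / r) * real k)"
    by (rule AE_level_count_le)
  then show ?thesis
  proof (rule AE_mp, intro AE_I2 impI)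
    fix x :: "nat list \<Rightarrow> nat"
    assume "\<forall>\<^sub>F k in sequentially. real (level_count M k x) \<le> exp (s * ln (1 / r) * real k)"
    then show "upper_box_dim (limit_set M r b x) \<le> ereal s"
      using upper_box_dim_limit_set_le[of M x "s * ln (1 / r)"] l M2 by simp
  qed
qed

text \<open>
  Choose \<open>t\<close> strictly between \<open>s\<close> and the growth rate, and a large \<open>k\<close> for which
  \<open>mean_count k\<close> exceeds \<open>exp (t l k)\<close>, where \<open>l = ln (1 / r)\<close>. The factor
  \<open>exp ((t - s) l k)\<close> absorbs the loss in \<open>heavy_tail\<close> and the constants of
  \<open>AE_regular_subtree\<close>, so that the number \<open>d\<close> of children is still at least \<open>exp (s l k)\<close>.
\<close>
lemma AE_hausdorff_dim_ge:
  assumes s: "0 < s" "ereal s < growth"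
  shows "AE x in tree_space. ereal s \<le> hausdorff_dim (limit_set M r b x)"
proof -
  define l where "l = ln (1 / r)"
  have l: "0 < l" unfolding l_def by (rule ln_inverse_ratio)
  obtain t where t: "s < t" "ereal t < growth"
    using ereal_dense2[OF s(2)] by auto
  have freq: "\<exists>\<^sub>F k in sequentially. ereal t < ereal (ln (mean_count k) / (real k * l))"
  proof (rule ccontr)
    assume "\<not> ?thesis"
    then have "\<forall>\<^sub>F k in sequentially. ereal (ln (mean_count k) / (real k * l)) \<le> ereal t"
      by (simp add: not_frequently not_less)
    then have "growth \<le> ereal t" unfolding growth_def l_def by (rule Limsup_bounded)
    with t(2) show False by order
  qed
  have lnM: "0 \<le> ln (real M)" using M2 by simp
  have pos: "0 < (t - s) * l" "0 < s * l" using t s l by auto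
  have ev: "\<forall>\<^sub>F k in sequentially. (1 + real k * ln (real M) \<le> exp ((t - s) * l * real k) / 8 \<and> 0 < k)
      \<and> 1 + real k * 2 \<le> exp (s * l * real k) / 8"
    by (intro eventually_conj linear_le_exp_eventually eventually_gt_at_top pos lnM) auto
  obtain k where k: "ereal t < ereal (ln (mean_count k) / (real k * l))"
    "1 + real k * ln (real M) \<le> exp ((t - s) * l * real k) / 8" "0 < k"
    "1 + real k * 2 \<le> exp (s * l * real k) / 8"
    using frequently_ex[OF frequently_eventually_frequently[OF freq ev]] by blast
  obtain h where h: "1 \<le> h" "mean_count k \<le> real h * tail_prob k h * (1 + real k * ln (real M))"
    using heavy_tail .
  define X where "X = real h * tail_prob k h"
  have "t * l * real k \<le> ln (mean_count k)" using k(1,3) l by (simp add: field_simps)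
  then have "exp (t * l * real k) \<le> mean_count k" using mean_bounds(1)[of k] by (simp add: ln_ge_iff)
  also have "\<dots> \<le> X * (1 + real k * ln (real M))" using h(2) by (simp add: X_def)
  also have "\<dots> \<le> X * (exp ((t - s) * l * real k) / 8)"
    using k(2) by (intro mult_left_mono) (auto simp: X_def tail_prob_def)
  finally have "exp (t * l * real k) / exp ((t - s) * l * real k) \<le> X / 8"
    by (simp add: field_simps)
  moreover have "exp (t * l * real k) / exp ((t - s) * l * real k) = exp (s * l * real k)"
    by (simp add: exp_diff[symmetric] algebra_simps)
  ultimately have X: "exp (s * l * real k) \<le> X / 8" by simp
  \<comment> \<open>This makes \<open>X\<close> at least 16, so that rounding \<open>X / 4\<close> down keeps at least \<open>X / 8\<close>.\<close>
  have "2 \<le> exp (s * l * real k)" using k(3,4) by linarith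
  then have X16: "16 \<le> X" using X by linarith
  define d where "d = nat \<lfloor>X / 4\<rfloor>"
  have d: "real d \<le> X / 4" "X / 8 \<le> real d" "1 < d"
    using X16 unfolding d_def by linarith+
  have "AE x in tree_space. \<exists>w. set w \<subseteq> {1..M} \<and> (\<forall>j. regular M k d j (subtree x w))"
    using X16 d(1) k(3) by (intro AE_regular_subtree[of k h]) (auto simp: X_def)
  then show ?thesis
  proof (rule AE_mp, intro AE_I2 impI)
    fix x assume x: "x \<in> space tree_space"
      and "\<exists>w. set w \<subseteq> {1..M} \<and> (\<forall>j. regular M k d j (subtree x w))"
    then obtain w where "set w \<subseteq> {1..M}" "\<And>j. regular M k d j (subtree x w)" by blast
    then have "ereal (ln (real d) / (real k * l)) \<le> hausdorff_dim (limit_set M r b x)"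
      unfolding l_def using label_in[OF x] k(3) d(3) by (intro hausdorff_dim_limit_set_ge) auto
    moreover have "s \<le> ln (real d) / (real k * l)"
    proof -
      have "exp (s * l * real k) \<le> real d" using X d(2) by linarith
      then have "s * l * real k \<le> ln (real d)" using d(3) by (simp add: ln_ge_iff)
      then show ?thesis using k(3) l by (simp add: field_simps)
    qed
    then have "ereal s \<le> ereal (ln (real d) / (real k * l))" by simp
    ultimately show "ereal s \<le> hausdorff_dim (limit_set M r b x)" by order
  qed
qed

theorem AE_limit_set_dims:
  "\<exists>a\<ge>0. AE x in tree_space. hausdorff_dim (limit_set M r b x) = ereal a \<and>
     lower_box_dim (limit_set M r b x) = ereal a \<and> upper_box_dim (limit_set M r b x) = ereal a"
proof -
  obtain a where a: "growth = ereal a" "0 \<le> a"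
    using growth_bounds by (cases growth) auto
  define up where "up m = a + 1 / real (Suc m)" for m
  \<comment> \<open>If \<open>a > 0\<close>, these numbers are positive and smaller than \<open>a\<close>, as \<open>AE_hausdorff_dim_ge\<close> demands; if
    \<open>a = 0\<close>, they are 0 and bound any dimension from below.\<close>
  define lo where "lo m = a * (1 - 1 / real (Suc (Suc m)))" for m
  have "(\<lambda>m. 1 / real (Suc m)) \<longlonglongrightarrow> 0" using LIMSEQ_inverse_real_of_nat by (simp add: inverse_eq_divide)
  from tendsto_add[OF tendsto_const[of a] this] have up: "up \<longlonglongrightarrow> a" by (simp add: up_def[abs_def])
  have "(\<lambda>m. 1 / real (Suc (Suc m))) \<longlonglongrightarrow> 0"
    using LIMSEQ_Suc[OF LIMSEQ_inverse_real_of_nat] by (simp add: inverse_eq_divide)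
  from tendsto_mult[OF tendsto_const[of a] tendsto_diff[OF tendsto_const[of 1] this]]
  have lo: "lo \<longlonglongrightarrow> a" by (simp add: lo_def[abs_def])
  have "AE x in tree_space. upper_box_dim (limit_set M r b x) \<le> ereal (up m)" for m
    using a by (intro AE_upper_box_dim_le) (simp add: up_def)
  then have up_all: "AE x in tree_space. \<forall>m. upper_box_dim (limit_set M r b x) \<le> ereal (up m)"
    by (simp add: AE_all_countable)
  have "AE x in tree_space. ereal (lo m) \<le> hausdorff_dim (limit_set M r b x)" for m
  proof (cases "a = 0")
    case True
    then show ?thesis using hausdorff_dim_nonneg by (intro AE_I2) (simp add: lo_def zero_ereal_def)
  next
    case False
    then have "0 < a" using a(2) by simp
    then have "a * (1 - 1 / real (Suc (Suc m))) < a * 1" by (intro mult_strict_left_mono) auto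
    then have "0 < lo m" "lo m < a" using \<open>0 < a\<close> by (auto simp: lo_def zero_less_mult_iff)
    then show ?thesis using a(1) by (intro AE_hausdorff_dim_ge) simp_all
  qed
  then have lo_all: "AE x in tree_space. \<forall>m. ereal (lo m) \<le> hausdorff_dim (limit_set M r b x)"
    by (simp add: AE_all_countable)
  from up_all lo_all
  have "AE x in tree_space. hausdorff_dim (limit_set M r b x) = ereal a \<and>
     lower_box_dim (limit_set M r b x) = ereal a \<and> upper_box_dim (limit_set M r b x) = ereal a"
  proof eventually_elim
    case (elim x)
    have "upper_box_dim (limit_set M r b x) \<le> ereal a"
      using elim(1) up by (intro LIMSEQ_le_const[of "\<lambda>m. ereal (up m)"]) auto
    moreover have "ereal a \<le> hausdorff_dim (limit_set M r b x)"
      using elim(2) lo by (intro LIMSEQ_le_const2[of "\<lambda>m. ereal (lo m)"]) auto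
    moreover have "hausdorff_dim (limit_set M r b x) \<le> lower_box_dim (limit_set M r b x)"
      by (intro hausdorff_dim_le_lower_box_dim limit_set_totally_bounded)
    moreover have "lower_box_dim (limit_set M r b x) \<le> upper_box_dim (limit_set M r b x)"
      by (rule lower_box_dim_le_upper_box_dim)
    ultimately show ?case by (intro conjI; order)
  qed
  with a(2) show ?thesis by blast
qed

end

section \<open>Breadth-first enumeration of the nodes\<close>

text \<open>
  All words below \<open>v\<close> are below \<open>w\<close> by transitivity, and \<open>v\<close> itself is one more; the predecessors of
  \<open>w\<close> are finite in number because they are not longer than \<open>w\<close>.
\<close>
lemma word_index_strict_mono:
  assumes w: "set w \<subseteq> {1..M}" and less: "(v, w) \<in> lenlex less_than" "set v \<subseteq> {1..M}"
  shows "word_index M v < word_index M w"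
  unfolding word_index_def
proof (rule psubset_card_mono)
  have "{u \<in> lists {1..M}. (u, w) \<in> lenlex less_than} \<subseteq> {u. set u \<subseteq> {1..M} \<and> length u \<le> length w}"
    using lenlex_length by (auto simp: lists_eq_set)
  then show "finite {u \<in> lists {1..M}. (u, w) \<in> lenlex less_than}"
    by (rule finite_subset) (rule finite_lists_length_le, simp)
  have "(v, v) \<notin> lenlex less_than" by (rule lenlex_irreflexive) simp
  moreover have "(u, w) \<in> lenlex less_than" if "(u, v) \<in> lenlex less_than" for u
    using lenlex_trans[OF that less(1)] by simp
  ultimately show "{u \<in> lists {1..M}. (u, v) \<in> lenlex less_than} \<subset> {u \<in> lists {1..M}. (u, w) \<in> lenlex less_than}"
    using less by (auto simp: lists_eq_set)
qed

lemma inj_on_word_index: "inj_on (word_index M) {w. set w \<subseteq> {1..M}}"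
proof (rule inj_onI, rule ccontr)
  fix v w assume vw: "v \<in> {w. set w \<subseteq> {1..M}}" "w \<in> {w. set w \<subseteq> {1..M}}"
    "word_index M v = word_index M w" "v \<noteq> w"
  have "total (lenlex less_than)" by (intro total_lenlex) (simp add: total_on_def less_than_iff linorder_neq_iff)
  then have "(v, w) \<in> lenlex less_than \<or> (w, v) \<in> lenlex less_than"
    using vw(4) by (auto simp: total_on_def)
  then show False
    using word_index_strict_mono[of w M v] word_index_strict_mono[of v M w] vw by auto
qed

lemma word_index_pos:
  assumes "w \<in> nodes M" shows "1 \<le> word_index M w"
  using word_index_strict_mono[of w M "[]"] assms by (simp add: nodes_def)

context random_fractal
begin

text \<open>
  Distinct nodes receive distinct positive indices, so reading the label sequence along the
  enumeration maps the sequence space to the tree space and preserves the measure.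
\<close>
lemma AE_label_space:
  assumes "AE x in tree_space. P x"
  shows "AE \<omega> in PiM {1..} (\<lambda>_. Q). P (restrict (edge_label M \<omega>) (nodes M))"
proof -
  let ?T = "\<lambda>\<omega>. \<lambda>u\<in>nodes M. \<omega> (word_index M u)"
  have pos: "word_index M u \<in> {1..}" if "u \<in> nodes M" for u
    using word_index_pos[OF that] by simp
  have T: "?T \<in> measurable (PiM {1..} (\<lambda>_. Q)) tree_space"
    unfolding tree_space_def using pos by (intro measurable_restrict measurable_component_singleton)
  have "inj_on (word_index M) (nodes M)"
    using inj_on_word_index by (rule inj_on_subset) (auto simp: nodes_def)
  then have "distr (PiM {1..} (\<lambda>_. Q)) (PiM (nodes M) (\<lambda>_. Q)) ?T = PiM (nodes M) (\<lambda>_. Q)"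
    using pos Q by (intro distr_PiM_reindex) auto
  then have d: "distr (PiM {1..} (\<lambda>_. Q)) tree_space ?T = tree_space" by (simp only: tree_space_def)
  have "AE x in distr (PiM {1..} (\<lambda>_. Q)) tree_space ?T. P x" unfolding d by (rule assms)
  from AE_distrD[OF T this] show ?thesis by (simp add: edge_label_def[abs_def])
qed

end

theorem proposition2p1:
  fixes N M :: nat and r :: real and b p :: "nat \<Rightarrow> real"
  assumes "N \<ge> 2" and "M \<ge> 2"
    and "0 < r" and "r \<le> 1 / real N"
    and "\<And>i. i \<in> {1..N} \<Longrightarrow> ifs_map r b i ` {0..1} \<subseteq> {0..1}"
    and "disjoint_family_on (\<lambda>i. ifs_map r b i ` {0<..<1}) {1..N}"
    and "\<And>i j x y. i \<in> {1..N} \<Longrightarrow> j \<in> {1..N} \<Longrightarrow> i < j \<Longrightarrow>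
           x \<in> ifs_map r b i ` {0..1} \<Longrightarrow> y \<in> ifs_map r b j ` {0..1} \<Longrightarrow> x \<le> y"
    and "\<And>i. i \<in> {1..N} \<Longrightarrow> 0 \<le> p i"
    and "(\<Sum>i=1..N. p i) = 1"
  shows "\<exists>a::real. a \<ge> 0 \<and>
    (AE \<omega> in label_measure N p.
       hausdorff_dim (random_set M r b \<omega>) = ereal a \<and>
       lower_box_dim (random_set M r b \<omega>) = ereal a \<and>
       upper_box_dim (random_set M r b \<omega>) = ereal a)"
proof -
  define Q where "Q = point_measure {1..N} (\<lambda>i. ennreal (p i))"
  have ends: "b i \<in> ifs_map r b i ` {0..1}" "b i + r \<in> ifs_map r b i ` {0..1}" for i
    using imageI[of 0 "{0..1}" "ifs_map r b i"] imageI[of 1 "{0..1}" "ifs_map r b i"]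
    by (simp_all add: ifs_map_def add.commute)
  have "1 / real N \<le> 1 / 2" using assms(1) by (intro divide_left_mono) auto
  then have r1: "r < 1" using assms(4) by linarith
  interpret random_fractal M Q N r b
  proof (intro random_fractal.intro label_tree.intro ordered_ifs.intro random_fractal_axioms.intro)
    show "2 \<le> M" "0 < r" "r < 1" by (fact assms(2), fact assms(3), fact r1)
    have "(\<Sum>i=1..N. ennreal (p i)) = 1"
      using assms(8,9) by (subst sum_ennreal) auto
    then show "prob_space Q" unfolding Q_def by (intro prob_space_point_measure) auto
    show "sets Q = Pow (space Q)" "space Q = {1..N}"
      by (simp_all add: Q_def sets_point_measure space_point_measure)
    show "0 \<le> b i" "b i + r \<le> 1" if "i \<in> {1..N}" for i
      using assms(5)[OF that] ends[of i] by auto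
    show "b i + r \<le> b j" if "i \<in> {1..N}" "j \<in> {1..N}" "i < j" for i j
      using assms(7)[OF that ends(2) ends(1)] .
  qed
  obtain a where "0 \<le> a" "AE x in tree_space. hausdorff_dim (limit_set M r b x) = ereal a \<and>
     lower_box_dim (limit_set M r b x) = ereal a \<and> upper_box_dim (limit_set M r b x) = ereal a"
    using AE_limit_set_dims by blast
  with AE_label_space[OF this(2)] show ?thesis
    unfolding label_measure_def Q_def[symmetric] limit_set_restrict random_set_eq_limit_set[symmetric]
    by blast
qed

end
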